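(* Let $a>0$, $b\ge0$, $\gamma>0$. 1. For every finite integer $L\ge1$, the iteratively log-adjusted shrinkage prior $$\pi(\theta)\propto\int_0^\infty \frac{1}{\sqrt{2\pi u}}\,e^{-\theta^2/(2u)}\,\frac{u^{a-1}}{(1+u)^{a+b}}\left\{\prod_{k=1}^{L-1}\frac1{f_k(1+u)}\right\}\frac1{f_L(1+u)^{1+\gamma}}\,du,\qquad\theta\in\mathbb{R},$$ satisfies: (i) $\pi(\theta)$ is proper, i.e. the integral over $\theta\in\mathbb{R}$ of the right-hand side is finite; (ii) if $a\le1/2$, then $\lim_{|\theta|\to0}\pi(\theta)=\infty$; (iii) as $|\theta|\to\infty$, $\pi(\theta)\propto|\theta|^{-2b-1}\ell(|\theta|)$ for some slowly varying function $\ell$, that is, there are a constant $c>0$ and a slowly varying function $\ell$ such that $\pi(\theta)/\{c\,|\theta|^{-2b-1}\ell(|\theta|)\}\to1$ as $|\theta|\to\infty$. 2. Suppose $b=0$, and for each integer $L\ge1$ let $\pi(\kappa;\gamma,L)$ be the probability density on $(0,1)$ proportional to $$\kappa^{b-1}(1-\kappa)^{a-1}\left\{\prod_{k=1}^{L-1}\frac1{f_k(1/\kappa)}\right\}\frac1{f_L(1/\kappa)^{1+\gamma}} .$$ Then for every $0<\varepsilon<1$, $$\lim_{L\to\infty}\int_0^{\varepsilon}\pi(\kappa;\gamma,L)\,d\kappa=1 .$$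
   Context: For $z\ge1$ define $f_1(z)=f(z)=1+\log z$ and inductively $f_{L+1}(z)=f(f_L(z))=1+\log f_L(z)$ for $L=1,2,\dots$. An empty product equals $1$. The iteratively log-adjusted shrinkage prior is the normal scale mixture $\theta\mid u\sim N(0,u)$ with $u>0$ having density proportional to $\frac{u^{a-1}}{(1+u)^{a+b}}\{\prod_{k=1}^{L-1}f_k(1+u)^{-1}\}f_L(1+u)^{-(1+\gamma)}$; the density $\pi(\kappa;\gamma,L)$ is the corresponding density of $\kappa=1/(1+u)$. A positive function $\ell$ on $(0,\infty)$ is slowly varying if $\lim_{M\to\infty}\ell(Mv)/\ell(M)=1$ for all $v>0$. *)

theory Defs
  imports "HOL-Analysis.Analysis"
begin

(* iter_log L is f_L for L >= 1; the value at L = 0 (the identity) never matters. *)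
primrec iter_log :: "nat \<Rightarrow> real \<Rightarrow> real" where
  "iter_log 0 z = z"
| "iter_log (Suc L) z = 1 + ln (iter_log L z)"

definition log_adjustment :: "real \<Rightarrow> nat \<Rightarrow> real \<Rightarrow> real" where
  "log_adjustment \<gamma> L z =
     (\<Prod>k\<in>{1..<L}. 1 / iter_log k z) * (1 / iter_log L z powr (1 + \<gamma>))"

(* The right-hand side of the prior, up to its normalizing constant. It is ennreal-valued,
   since for a <= 1/2 the integral diverges at \<theta> = 0. *)
definition ila_prior_kernel :: "real \<Rightarrow> real \<Rightarrow> real \<Rightarrow> nat \<Rightarrow> real \<Rightarrow> ennreal" where
  "ila_prior_kernel a b \<gamma> L \<theta> =
     (\<integral>\<^sup>+u\<in>{0<..}. ennreal (1 / sqrt (2 * pi * u) * exp (- (\<theta>\<^sup>2 / (2 * u)))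
        * (u powr (a - 1) / (1 + u) powr (a + b)) * log_adjustment \<gamma> L (1 + u)) \<partial>lborel)"

definition kappa_kernel :: "real \<Rightarrow> real \<Rightarrow> real \<Rightarrow> nat \<Rightarrow> real \<Rightarrow> ennreal" where
  "kappa_kernel a b \<gamma> L \<kappa> =
     ennreal (\<kappa> powr (b - 1) * (1 - \<kappa>) powr (a - 1) * log_adjustment \<gamma> L (1 / \<kappa>))
       * indicator {0<..<1} \<kappa>"

(* The probability density proportional to g. If g has infinite integral, this is 0 wherever
   g is finite, so it then does not pass for a density. *)
definition normalized :: "(real \<Rightarrow> ennreal) \<Rightarrow> real \<Rightarrow> ennreal" where
  "normalized g x = g x / (\<integral>\<^sup>+y. g y \<partial>lborel)"

definition ila_prior :: "real \<Rightarrow> real \<Rightarrow> real \<Rightarrow> nat \<Rightarrow> real \<Rightarrow> ennreal" where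
  "ila_prior a b \<gamma> L = normalized (ila_prior_kernel a b \<gamma> L)"

definition kappa_density :: "real \<Rightarrow> real \<Rightarrow> real \<Rightarrow> nat \<Rightarrow> real \<Rightarrow> ennreal" where
  "kappa_density a b \<gamma> L = normalized (kappa_kernel a b \<gamma> L)"

definition slowly_varying :: "(real \<Rightarrow> real) \<Rightarrow> bool" where
  "slowly_varying l \<longleftrightarrow>
     (\<forall>x>0. l x > 0) \<and> (\<forall>v>0. ((\<lambda>M. l (M * v) / l M) \<longlongrightarrow> 1) at_top)"

end

theory Submission
  imports Defs "HOL-Probability.Distributions" "HOL-Real_Asymp.Real_Asymp"
begin

text \<open>Write \<open>h\<close> for the log adjustment of level \<open>L\<close>. Since \<open>f\<^sub>L'(z) = 1 / (z f\<^sub>1(z) \<dots> f\<^bsub>L-1\<^esub>(z))\<close>, the function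
  \<open>h(z) / z\<close> is the derivative of \<open>- f\<^sub>L(z) powr (- \<gamma>) / \<gamma>\<close>, hence integrable at infinity; with Tonelli
  this gives propriety. For \<open>a \<le> 1/2\<close> and small \<open>\<theta>\<close> the kernel is bounded below by a multiple of
  \<open>\<integral> du/u\<close> over \<open>[\<theta>\<^sup>2, 1]\<close>. For the tail substitute \<open>u = \<theta>\<^sup>2 s\<close> and use dominated convergence
  with \<open>\<ell>(M) = h(1 + M\<^sup>2)\<close>: all \<open>f\<^sub>k\<close> are 1-Lipschitz in \<open>ln z\<close>, so \<open>\<ell>\<close> varies slowly, and
  \<open>h(x) / h(y) \<le> (y/x) powr (L + \<gamma>)\<close> is absorbed by \<open>exp (- 1/(2s))\<close>.
  For part 2, \<open>f\<^sub>k - 1 \<le> f\<^sub>k (f\<^bsub>k+1\<^esub> - 1)\<close> telescopes to \<open>h \<le> (f\<^sub>L - 1) / (f\<^sub>1 - 1)\<close>, which tends to 0 as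
  \<open>L\<close> grows: the mass on \<open>[\<epsilon>, 1)\<close> vanishes, while the total mass stays bounded below by a multiple
  of \<open>f\<^sub>L(2) powr (- \<gamma>) \<ge> 2 powr (- \<gamma>)\<close>.\<close>

subsection \<open>The iterated logarithms\<close>

lemma iter_log_ge_1: "1 \<le> z \<Longrightarrow> 1 \<le> iter_log k z"
  by (induction k) auto

lemma iter_log_pos: "1 \<le> z \<Longrightarrow> 0 < iter_log k z"
  using iter_log_ge_1[of z k] by linarith

lemma iter_log_mono: "1 \<le> x \<Longrightarrow> x \<le> y \<Longrightarrow> iter_log k x \<le> iter_log k y"
proof (induction k)
  case (Suc k)
  then show ?case
    using iter_log_pos[of x k] iter_log_pos[of y k] by simp
qed simp

lemma iter_log_le_self: "1 \<le> z \<Longrightarrow> iter_log k z \<le> z"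
proof (induction k)
  case (Suc k)
  then show ?case
    using ln_le_minus_one[OF iter_log_pos[of z k]] by simp
qed simp

lemma iter_log_at_top: "filterlim (iter_log k) at_top at_top"
proof (induction k)
  case 0
  then show ?case by (simp add: filterlim_ident)
next
  case (Suc k)
  have "filterlim (\<lambda>z. 1 + ln (iter_log k z)) at_top at_top"
    by (intro filterlim_tendsto_add_at_top[OF tendsto_const] filterlim_compose[OF ln_at_top Suc])
  then show ?case by simp
qed

text \<open>At the first level this is an equality. Each further level composes with
  \<open>ln\<close>, which is 1-Lipschitz on [1, \<infinity>): for 1 \<le> u \<le> v, ln (v/u) \<le>
  v/u - 1 \<le> v - u. The index \<open>Suc k\<close> leaves out the identity, which is not
  Lipschitz in \<open>ln z\<close>.\<close>

lemma iter_log_diff_le: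
  assumes "1 \<le> x" "x \<le> y"
  shows "iter_log (Suc k) y - iter_log (Suc k) x \<le> ln y - ln x"
proof (induction k)
  case (Suc k)
  let ?g = "iter_log (Suc k)"
  have x: "1 \<le> ?g x" and y: "?g x \<le> ?g y"
    using assms by (simp_all only: iter_log_ge_1 iter_log_mono)
  have "ln (?g y / ?g x) \<le> ?g y / ?g x - 1"
    using x y by (intro ln_le_minus_one) auto
  also have "\<dots> = (?g y - ?g x) / ?g x"
    using x by (simp add: diff_divide_distrib del: iter_log.simps)
  also have "\<dots> \<le> (?g y - ?g x) / 1"
    using x y by (intro divide_left_mono) auto
  finally have "ln (?g y) - ln (?g x) \<le> ?g y - ?g x"
    using x y by (simp add: ln_div del: iter_log.simps)
  then show ?case
    using Suc by (simp del: iter_log.simps add: iter_log.simps(2)[of "Suc k"])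
qed simp

lemma abs_iter_log_diff_le:
  assumes "1 \<le> x" "1 \<le> y"
  shows "\<bar>iter_log (Suc k) x - iter_log (Suc k) y\<bar> \<le> \<bar>ln x - ln y\<bar>"
  using iter_log_diff_le[of x y k] iter_log_diff_le[of y x k]
    iter_log_mono[of x y "Suc k"] iter_log_mono[of y x "Suc k"] assms
  by (cases "x \<le> y") (simp_all del: iter_log.simps)

text \<open>Above level 0 the increase is at most ln (y/x) \<le> y/x - 1, and
  \<open>iter_log k x\<close> \<ge> 1 turns this additive bound into a multiplicative one.\<close>

lemma iter_log_le_scaled:
  assumes "1 \<le> x" "x \<le> y"
  shows "iter_log k y \<le> y / x * iter_log k x"
proof (cases k)
  case 0
  then show ?thesis using assms by simp
next
  case (Suc m)
  have "iter_log k y \<le> iter_log k x + ln (y / x)"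
    using iter_log_diff_le[OF assms, of m] Suc assms by (simp add: ln_div del: iter_log.simps)
  also have "\<dots> \<le> iter_log k x + (y / x - 1)"
    using assms by (intro add_left_mono ln_le_minus_one) auto
  also have "\<dots> \<le> iter_log k x + (y / x - 1) * iter_log k x"
    using assms iter_log_ge_1[of x k] by (simp add: mult_le_cancel_left1)
  finally show ?thesis by (simp add: algebra_simps)
qed

text \<open>The sequence decreases and stays above 1, so it converges to a fixed point of 1 + ln;
  the only such point is 1.\<close>

lemma iter_log_tendsto_1:
  assumes "1 \<le> z"
  shows "(\<lambda>k. iter_log k z) \<longlonglongrightarrow> 1"
proof -
  have dec: "decseq (\<lambda>k. iter_log k z)"
  proof (rule decseq_SucI)
    show "iter_log (Suc k) z \<le> iter_log k z" for k
      using ln_le_minus_one[OF iter_log_pos[OF assms], of k] by simp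
  qed
  obtain l where l: "(\<lambda>k. iter_log k z) \<longlonglongrightarrow> l"
    by (rule decseq_convergent[OF dec]) (use iter_log_ge_1[OF assms] in auto)
  have l1: "1 \<le> l"
    using l by (rule LIMSEQ_le_const) (use iter_log_ge_1[OF assms] in auto)
  have "(\<lambda>k. 1 + ln (iter_log k z)) \<longlonglongrightarrow> 1 + ln l"
    using l l1 by (intro tendsto_intros) auto
  then have "(\<lambda>k. iter_log (Suc k) z) \<longlonglongrightarrow> 1 + ln l" by simp
  moreover have "(\<lambda>k. iter_log (Suc k) z) \<longlonglongrightarrow> l"
    using l by (rule LIMSEQ_Suc)
  ultimately have "l = 1 + ln l" by (rule LIMSEQ_unique[symmetric])
  then have "l = 1" using l1 by (intro ln_eq_minus_one) auto
  with l show ?thesis by simp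
qed

text \<open>Repeated chain rule. The product starts with the level 0 factor, which is z itself, and
  this is where the z in the denominator of h(z)/z comes from.\<close>

lemma iter_log_has_real_derivative:
  assumes "1 \<le> z"
  shows "(iter_log k has_real_derivative 1 / (\<Prod>j<k. iter_log j z)) (at z)"
proof (induction k)
  case 0
  then show ?case by simp
next
  case (Suc k)
  have "((\<lambda>z. 1 + ln (iter_log k z)) has_real_derivative 1 / (\<Prod>j<Suc k. iter_log j z)) (at z)"
    by (rule derivative_eq_intros Suc refl iter_log_pos assms)+ (simp add: field_simps)
  then show ?case by simp
qed

lemma measurable_iter_log [measurable]: "iter_log k \<in> borel_measurable borel"
proof (induction k)
  case (Suc k)
  then have [measurable]: "iter_log k \<in> borel_measurable borel" .
  show ?case by simp
qed simp

section \<open>The log adjustment: monotonicity, scaling, limits and antiderivative\<close>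

lemma measurable_log_adjustment [measurable]: "log_adjustment \<gamma> L \<in> borel_measurable borel"
  unfolding log_adjustment_def[abs_def] by measurable

lemma log_adjustment_pos: "1 \<le> z \<Longrightarrow> 0 < log_adjustment \<gamma> L z"
  unfolding log_adjustment_def using iter_log_pos[of z]
  by (auto intro!: mult_pos_pos divide_pos_pos prod_pos simp: less_imp_neq[symmetric])

lemma log_adjustment_antimono:
  assumes "0 < \<gamma>" "1 \<le> x" "x \<le> y"
  shows "log_adjustment \<gamma> L y \<le> log_adjustment \<gamma> L x"
proof -
  have y: "1 \<le> y" using assms by simp
  have *: "iter_log k x \<le> iter_log k y" "0 < iter_log k x" "0 < iter_log k y" for k
    using assms y by (auto intro: iter_log_mono iter_log_pos)
  have "1 / iter_log k y \<le> 1 / iter_log k x" for k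
    using *[of k] by (intro divide_left_mono) auto
  moreover have "1 / iter_log L y powr (1 + \<gamma>) \<le> 1 / iter_log L x powr (1 + \<gamma>)"
    using *[of L] assms by (intro divide_left_mono powr_mono2) auto
  ultimately show ?thesis
    unfolding log_adjustment_def using *
    by (intro mult_mono prod_mono prod_nonneg conjI) (auto intro: less_imp_le)
qed

lemma log_adjustment_le_1:
  assumes "0 < \<gamma>" "1 \<le> z"
  shows "log_adjustment \<gamma> L z \<le> 1"
proof -
  have "iter_log k 1 = 1" for k by (induction k) auto
  then have "log_adjustment \<gamma> L 1 = 1" by (simp add: log_adjustment_def)
  then show ?thesis using log_adjustment_antimono[of \<gamma> 1 z L] assms by simp
qed

text \<open>Each of the L - 1 simple factors costs at most one factor y/x and the last one (y/x)
  powr (1 + \<gamma>), which adds up to the exponent L + \<gamma>. The bound controls the log ratio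
  for small s in the tail analysis.\<close>

lemma log_adjustment_le_scaled:
  assumes "0 < \<gamma>" "1 \<le> x" "x \<le> y" "1 \<le> L"
  shows "log_adjustment \<gamma> L x \<le> (y / x) powr (L + \<gamma>) * log_adjustment \<gamma> L y"
proof -
  let ?r = "y / x"
  have y: "1 \<le> y" and r: "1 \<le> ?r" using assms by auto
  have pos: "0 < iter_log k x" "0 < iter_log k y" for k
    using assms y by (auto intro: iter_log_pos)
  have *: "1 / iter_log k x \<le> ?r * (1 / iter_log k y)" for k
    using iter_log_le_scaled[of x y k] assms pos[of k] by (simp add: field_simps)
  have "log_adjustment \<gamma> L x = (\<Prod>k\<in>{1..<L}. 1 / iter_log k x) * (1 / iter_log L x) powr (1 + \<gamma>)"
    using pos[of L] by (simp add: log_adjustment_def powr_divide)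
  also have "\<dots> \<le> (\<Prod>k\<in>{1..<L}. ?r * (1 / iter_log k y)) * (?r * (1 / iter_log L y)) powr (1 + \<gamma>)"
    using * pos assms by (intro mult_mono prod_mono powr_mono2 prod_nonneg conjI) (auto intro: less_imp_le)
  also have "\<dots> = (?r ^ (L - 1) * ?r powr (1 + \<gamma>)) *
      ((\<Prod>k\<in>{1..<L}. 1 / iter_log k y) * (1 / iter_log L y) powr (1 + \<gamma>))"
    using r pos[of L] by (subst prod.distrib, subst powr_mult) (auto simp: mult_ac)
  also have "?r ^ (L - 1) * ?r powr (1 + \<gamma>) = ?r powr (L + \<gamma>)"
    using r assms by (simp add: powr_realpow[symmetric] powr_add[symmetric] of_nat_diff)
  also have "(\<Prod>k\<in>{1..<L}. 1 / iter_log k y) * (1 / iter_log L y) powr (1 + \<gamma>) = log_adjustment \<gamma> L y"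
    using pos[of L] by (simp add: log_adjustment_def powr_divide)
  finally show ?thesis .
qed

text \<open>By the Lipschitz bound in \<open>ln\<close>, the numerators and denominators at each
  level differ by at most K while the denominators tend to infinity. The ratio of adjustments is a
  finite product of powers of such level ratios.\<close>

lemma log_adjustment_ratio_tendsto:
  fixes x y :: "'a \<Rightarrow> real"
  assumes "filterlim y at_top F" "\<And>t. 1 \<le> x t" "\<And>t. 1 \<le> y t"
    and K: "\<And>t. \<bar>ln (x t) - ln (y t)\<bar> \<le> K" and L: "1 \<le> L"
  shows "((\<lambda>t. log_adjustment \<gamma> L (x t) / log_adjustment \<gamma> L (y t)) \<longlongrightarrow> 1) F"
proof -
  have pos: "0 < iter_log k (x t)" "0 < iter_log k (y t)" for k t
    using assms by (auto intro: iter_log_pos)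
  have 1: "((\<lambda>t. iter_log k (x t) / iter_log k (y t)) \<longlongrightarrow> 1) F" if k: "1 \<le> k" for k
  proof -
    obtain m where m: "k = Suc m" using k by (cases k) auto
    have lim: "((\<lambda>t. K * inverse (iter_log k (y t))) \<longlongrightarrow> K * 0) F"
      by (intro tendsto_mult tendsto_const tendsto_inverse_0_at_top
          filterlim_compose[OF iter_log_at_top assms(1)])
    have bd: "norm (iter_log k (x t) / iter_log k (y t) - 1) \<le> K * inverse (iter_log k (y t))" for t
    proof -
      have "iter_log k (x t) / iter_log k (y t) - 1
          = (iter_log k (x t) - iter_log k (y t)) * inverse (iter_log k (y t))"
        using pos(2)[of k t] by (simp add: field_simps)
      moreover have "\<bar>iter_log k (x t) - iter_log k (y t)\<bar> \<le> K"
        using abs_iter_log_diff_le[OF assms(2)[of t] assms(3)[of t], of m] K[of t] unfolding m by linarith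
      ultimately show ?thesis
        using pos(2)[of k t] by (simp add: abs_mult mult_right_mono)
    qed
    have "((\<lambda>t. iter_log k (x t) / iter_log k (y t) - 1) \<longlongrightarrow> 0) F"
      using lim by (intro Lim_null_comparison[OF always_eventually[OF allI[OF bd]]]) simp
    then show ?thesis by (simp add: LIM_zero_iff)
  qed
  have eq: "log_adjustment \<gamma> L (x t) / log_adjustment \<gamma> L (y t) =
     inverse (\<Prod>k\<in>{1..<L}. iter_log k (x t) / iter_log k (y t))
       * inverse ((iter_log L (x t) / iter_log L (y t)) powr (1 + \<gamma>))" for t
    using pos[of L t] unfolding log_adjustment_def
    by (simp add: prod_dividef powr_divide divide_simps)
  have "((\<lambda>t. inverse (\<Prod>k\<in>{1..<L}. iter_log k (x t) / iter_log k (y t))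
       * inverse ((iter_log L (x t) / iter_log L (y t)) powr (1 + \<gamma>))) \<longlongrightarrow>
      inverse (\<Prod>k\<in>{1..<L}. 1) * inverse (1 powr (1 + \<gamma>))) F"
    using L by (intro tendsto_intros 1) auto
  then show ?thesis by (simp add: eq)
qed

text \<open>The powered last factor is at most 1, so the product of the others suffices. Since z >
  1, every excess \<open>g k\<close> is positive; \<open>g 1\<close> is a fixed positive number,
  while \<open>g L\<close> tends to 0 because \<open>iter_log L z\<close> tends to 1.\<close>

lemma log_adjustment_tendsto_0:
  assumes "0 < \<gamma>" "1 < z"
  shows "(\<lambda>L. log_adjustment \<gamma> L z) \<longlonglongrightarrow> 0"
proof -
  define g where "g k = iter_log k z - 1" for k
  have g_pos: "0 < g k" for k
    unfolding g_def by (induction k) (use assms in auto)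
  have f_pos: "0 < iter_log k z" for k using assms by (auto intro: iter_log_pos)
  \<comment> \<open>\<open>ln (1 + g) \<ge> g / (1 + g)\<close>, so the product telescopes\<close>
  have step: "1 / iter_log k z \<le> g (Suc k) / g k" for k
  proof -
    have "ln (1 / iter_log k z) \<le> 1 / iter_log k z - 1"
      using f_pos[of k] by (intro ln_le_minus_one) auto
    then have "1 - 1 / iter_log k z \<le> g (Suc k)"
      using f_pos[of k] by (simp add: g_def ln_div)
    also have "1 - 1 / iter_log k z = g k * (1 / iter_log k z)"
      using f_pos[of k] by (simp add: g_def field_simps)
    finally show ?thesis using g_pos[of k] by (simp add: field_simps)
  qed
  have prod: "(\<Prod>k\<in>{1..<Suc n}. 1 / iter_log k z) \<le> g (Suc n) / g 1" for n
  proof (induction n)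
    case 0
    then show ?case using g_pos[of 1] by simp
  next
    case (Suc n)
    have "(\<Prod>k\<in>{1..<Suc n}. 1 / iter_log k z) * (1 / iter_log (Suc n) z)
        \<le> g (Suc n) / g 1 * (g (Suc (Suc n)) / g (Suc n))"
      using g_pos[of 1] g_pos[of "Suc n"] f_pos
      by (intro mult_mono Suc step divide_nonneg_nonneg) (auto simp: less_imp_le simp del: iter_log.simps)
    then have "(\<Prod>k\<in>{1..<Suc (Suc n)}. 1 / iter_log k z)
        \<le> g (Suc n) / g 1 * (g (Suc (Suc n)) / g (Suc n))"
      by (subst prod.atLeastLessThan_Suc) (simp_all del: iter_log.simps)
    then show ?case using g_pos[of "Suc n"] by simp
  qed
  have bound: "log_adjustment \<gamma> (Suc n) z \<le> g (Suc n) / g 1" for n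
  proof -
    have "1 / iter_log (Suc n) z powr (1 + \<gamma>) \<le> 1"
      using iter_log_ge_1[of z "Suc n"] assms by (simp add: ge_one_powr_ge_zero del: iter_log.simps)
    moreover have "0 \<le> (\<Prod>k\<in>{1..<Suc n}. 1 / iter_log k z)"
      using f_pos by (intro prod_nonneg) (auto simp: less_imp_le)
    ultimately have "log_adjustment \<gamma> (Suc n) z \<le> (\<Prod>k\<in>{1..<Suc n}. 1 / iter_log k z)"
      unfolding log_adjustment_def by (rule mult_left_le)
    with prod[of n] show ?thesis by linarith
  qed
  have "g \<longlonglongrightarrow> 0"
    unfolding g_def using tendsto_diff[OF iter_log_tendsto_1[of z] tendsto_const[of 1]] assms by simp
  then have "(\<lambda>n. g (Suc n) / g 1) \<longlonglongrightarrow> 0 / g 1"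
    using g_pos[of 1] by (intro tendsto_divide tendsto_const LIMSEQ_Suc) auto
  then have *: "(\<lambda>n. g (Suc n) / g 1) \<longlonglongrightarrow> 0" by simp
  have "(\<lambda>n. log_adjustment \<gamma> (Suc n) z) \<longlonglongrightarrow> 0"
  proof (rule tendsto_sandwich[OF _ _ tendsto_const *])
    show "\<forall>\<^sub>F n in sequentially. 0 \<le> log_adjustment \<gamma> (Suc n) z"
      using log_adjustment_pos[of z \<gamma>] assms by (simp add: less_imp_le)
    show "\<forall>\<^sub>F n in sequentially. log_adjustment \<gamma> (Suc n) z \<le> g (Suc n) / g 1"
      using bound by simp
  qed
  \<comment> \<open>The estimates hold for levels \<open>Suc n\<close>; dropping level 0 does not
    affect the limit.\<close>
  then show ?thesis by (rule LIMSEQ_imp_Suc)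
qed

lemma iter_log_powr_has_real_derivative:
  assumes "0 < \<gamma>" "1 \<le> z" "1 \<le> L"
  shows "((\<lambda>z. - (iter_log L z powr - \<gamma>) / \<gamma>) has_real_derivative log_adjustment \<gamma> L z / z) (at z)"
proof -
  have pos: "0 < iter_log L z" using assms by (intro iter_log_pos)
  \<comment> \<open>Splitting off the level 0 factor z leaves exactly the product inside
    \<open>log_adjustment\<close>.\<close>
  have "(\<Prod>j<L. iter_log j z) = z * (\<Prod>k\<in>{1..<L}. iter_log k z)"
    using assms by (simp add: lessThan_atLeast0 prod.atLeast_Suc_lessThan)
  moreover have "- \<gamma> - 1 = - (1 + \<gamma>)" by simp
  then have "iter_log L z powr (- \<gamma> - 1) = 1 / iter_log L z powr (1 + \<gamma>)"
    by (simp only: powr_minus_divide)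
  ultimately have eq: "log_adjustment \<gamma> L z / z
      = iter_log L z powr (- \<gamma> - 1) * (1 / (\<Prod>j<L. iter_log j z))"
    using assms by (simp add: log_adjustment_def prod_dividef)
  have "((\<lambda>z. - (iter_log L z powr - \<gamma>) / \<gamma>) has_real_derivative
      - (- \<gamma> * iter_log L z powr (- \<gamma> - 1) * (1 / (\<Prod>j<L. iter_log j z))) / \<gamma>) (at z)"
    using assms
    by (intro DERIV_cdivide DERIV_minus DERIV_chain2[of "\<lambda>x. x powr - \<gamma>" _ "iter_log L"] 
        iter_log_has_real_derivative has_real_derivative_powr pos) auto
  then show ?thesis unfolding eq using assms by simp
qed

subsection \<open>Propriety of the prior\<close>

text \<open>A vanishing integral would force g = 0 almost everywhere, yet (p, q) has positive
  measure. This keeps the normalizing constant and the limit integral away from 0.\<close>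

lemma nn_integral_pos:
  fixes g :: "real \<Rightarrow> ennreal"
  assumes [measurable]: "g \<in> borel_measurable borel"
    and "p < q" and pos: "\<And>x. p < x \<Longrightarrow> x < q \<Longrightarrow> 0 < g x"
  shows "0 < (\<integral>\<^sup>+x. g x \<partial>lborel)"
proof (rule ccontr)
  assume "\<not> ?thesis"
  then have "AE x in lborel. g x = 0"
    by (simp add: nn_integral_0_iff_AE zero_less_iff_neq_zero)
  then have "AE x in lborel. x \<notin> {p<..<q}"
    by eventually_elim (use pos in force)
  then have "emeasure lborel {p<..<q} = 0"
    by (subst (asm) AE_iff_measurable[of "{p<..<q}"]) auto
  with \<open>p < q\<close> show False by simp
qed

text \<open>Only one-sided limits of F are required at the endpoints, so integrands that are
  singular there are covered.\<close>

lemma set_integral_FTC_Ioo: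
  fixes f F :: "real \<Rightarrow> real"
  assumes "c < d"
    and "\<And>x. c < x \<Longrightarrow> x < d \<Longrightarrow> (F has_real_derivative f x) (at x)"
    and "\<And>x. c < x \<Longrightarrow> x < d \<Longrightarrow> isCont f x"
    and "\<And>x. c < x \<Longrightarrow> x < d \<Longrightarrow> 0 \<le> f x"
    and "(F \<longlongrightarrow> A) (at_right c)" "(F \<longlongrightarrow> B) (at_left d)"
  shows "set_integrable lborel {c<..<d} f" "(LINT x:{c<..<d}|lborel. f x) = B - A"
proof -
  have "set_integrable lborel (einterval c d) f \<and> (LBINT x=c..d. f x) = B - A"
    using assms
    by (intro conjI interval_integral_FTC_nonneg[of "ereal c" "ereal d" F f A B])
      (auto simp: ereal_tendsto_simps)
  then show "set_integrable lborel {c<..<d} f" "(LINT x:{c<..<d}|lborel. f x) = B - A"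
    using assms(1) by (auto simp: interval_lebesgue_integral_def)
qed

text \<open>The sign of a - 1 is unknown. Writing the power as \<open>x powr a / x\<close> gives
  two-sided bounds for every a > 0; they are applied to u/(1 + u) and to 1 - \<kappa>.\<close>

lemma powr_minus_one_bounds:
  fixes a x :: real
  assumes "0 < a" "1/2 \<le> x" "x \<le> 1"
  shows "(1/2) powr a \<le> x powr (a - 1)" "x powr (a - 1) \<le> 2"
proof -
  have eq: "x powr (a - 1) = x powr a / x" using assms by (simp add: powr_diff)
  have "(1/2) powr a \<le> x powr a" using assms by (intro powr_mono2) auto
  also have "\<dots> \<le> x powr a / x" using assms by (simp add: field_simps mult_left_le)
  finally show "(1/2) powr a \<le> x powr (a - 1)" by (simp add: eq)
  have "x powr a / x \<le> 1 / (1/2)"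
    using assms by (intro frac_le powr_le1) auto
  then show "x powr (a - 1) \<le> 2" by (simp add: eq)
qed

lemma set_integrable_powr:
  fixes a :: real
  assumes "0 < a"
  shows "set_integrable lborel {0<..<1} (\<lambda>x. x powr (a - 1))"
    and "set_integrable lborel {0<..<1} (\<lambda>x. (1 - x) powr (a - 1))"
proof -
  show *: "set_integrable lborel {0<..<1} (\<lambda>x. x powr (a - 1))"
  proof (rule set_integral_FTC_Ioo[where F = "\<lambda>x. x powr a / a" and A = 0 and B = "1 powr a / a"])
    show "((\<lambda>x. x powr a / a) \<longlongrightarrow> 0) (at_right 0)"
      using assms by real_asymp
    show "((\<lambda>x. x powr a / a) \<longlongrightarrow> 1 powr a / a) (at_left 1)"
      using assms by (intro tendsto_intros) auto
  qed (use assms in \<open>auto intro!: derivative_eq_intros continuous_intros\<close>)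
  \<comment> \<open>Reflection x -> 1 - x, written as an affine map of slope -1.\<close>
  have "integrable lborel (\<lambda>x. indicator {0<..<1} (1 + (-1) * x) *\<^sub>R (1 + (-1) * x) powr (a - 1))"
    using * unfolding set_integrable_def by (rule lborel_integrable_real_affine) simp
  then show "set_integrable lborel {0<..<1} (\<lambda>x. (1 - x) powr (a - 1))"
    unfolding set_integrable_def
    by (rule Bochner_Integration.integrable_cong[THEN iffD1, rotated 2]) (auto simp: indicator_def)
qed

lemma nn_set_integral_eq_ennreal_set_integral:
  assumes "set_integrable M A f" and "\<And>x. x \<in> A \<Longrightarrow> 0 \<le> f x"
  shows "(\<integral>\<^sup>+x\<in>A. ennreal (f x) \<partial>M) = ennreal (LINT x:A|M. f x)"
proof -
  have "(\<integral>\<^sup>+x\<in>A. ennreal (f x) \<partial>M) = (\<integral>\<^sup>+x. ennreal (indicator A x *\<^sub>R f x) \<partial>M)"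
    by (intro nn_integral_cong) (auto simp: indicator_def)
  also have "\<dots> = ennreal (LINT x:A|M. f x)"
    unfolding set_lebesgue_integral_def using assms
    by (intro nn_integral_eq_integral) (auto simp: set_integrable_def indicator_def)
  finally show ?thesis .
qed

lemma isCont_log_adjustment:
  assumes "1 \<le> z"
  shows "isCont (log_adjustment \<gamma> L) z"
proof -
  have "isCont (iter_log k) z" for k
    using iter_log_has_real_derivative[OF assms] by (rule DERIV_isCont)
  moreover have "iter_log k z \<noteq> 0" for k using iter_log_pos[OF assms, of k] by simp
  ultimately show ?thesis
    unfolding log_adjustment_def[abs_def] by (intro continuous_intros) auto
qed

lemma iter_log_powr_tendsto_0:
  assumes "0 < \<gamma>"
  shows "((\<lambda>z. - (iter_log L z powr - \<gamma>) / \<gamma>) \<longlongrightarrow> 0) at_top"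
proof -
  have "((\<lambda>z. - (iter_log L z powr - \<gamma>) / \<gamma>) \<longlongrightarrow> - 0 / \<gamma>) at_top"
    using assms
    by (intro tendsto_divide tendsto_minus tendsto_const tendsto_neg_powr iter_log_at_top) auto
  then show ?thesis by simp
qed

text \<open>The antiderivative vanishes at infinity, so only its value at u = 1, that is at z = 2,
  remains.\<close>

lemma nn_integral_log_adjustment_tail:
  assumes "0 < \<gamma>" "1 \<le> L"
  shows "(\<integral>\<^sup>+u\<in>{1..}. ennreal (log_adjustment \<gamma> L (1 + u) / (1 + u)) \<partial>lborel)
    = ennreal (iter_log L 2 powr - \<gamma> / \<gamma>)"
proof -
  let ?F = "\<lambda>u. - (iter_log L (1 + u) powr - \<gamma>) / \<gamma>"
  have "(\<integral>\<^sup>+u\<in>{1..}. ennreal (log_adjustment \<gamma> L (1 + u) / (1 + u)) \<partial>lborel) = ennreal (0 - ?F 1)"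
  proof (rule nn_integral_FTC_atLeast[where F = ?F])
    show "(?F has_real_derivative log_adjustment \<gamma> L (1 + u) / (1 + u)) (at u)" if "1 \<le> u" for u
      using DERIV_shift[of "\<lambda>z. - (iter_log L z powr - \<gamma>) / \<gamma>" _ u 1] that assms
        iter_log_powr_has_real_derivative[of \<gamma> "1 + u" L]
      by (simp add: add.commute)
    show "(?F \<longlongrightarrow> 0) at_top"
      by (rule filterlim_compose[OF iter_log_powr_tendsto_0[OF assms(1)]])
        (intro filterlim_tendsto_add_at_top[OF tendsto_const] filterlim_ident)
  qed (auto intro!: divide_nonneg_nonneg less_imp_le[OF log_adjustment_pos])
  then show ?thesis by simp
qed

text \<open>The same antiderivative, read through z = 1/\<kappa>: the inner derivative turns h(z)/z
  into h(1/\<kappa>)/\<kappa>, and the cut at 1/2 corresponds to z = 2.\<close>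

lemma set_integral_log_adjustment_inverse:
  assumes "0 < \<gamma>" "1 \<le> L"
  shows "set_integrable lborel {0<..<1/2} (\<lambda>\<kappa>. log_adjustment \<gamma> L (1 / \<kappa>) / \<kappa>)"
    and "(LINT \<kappa>:{0<..<1/2}|lborel. log_adjustment \<gamma> L (1 / \<kappa>) / \<kappa>) = iter_log L 2 powr - \<gamma> / \<gamma>"
proof -
  let ?G = "\<lambda>z. - (iter_log L z powr - \<gamma>) / \<gamma>"
  let ?F = "\<lambda>\<kappa>. - ?G (1 / \<kappa>)"
  let ?f = "\<lambda>\<kappa>. log_adjustment \<gamma> L (1 / \<kappa>) / \<kappa>"
  have der: "(?F has_real_derivative ?f \<kappa>) (at \<kappa>)" if "0 < \<kappa>" "\<kappa> \<le> 1/2" for \<kappa>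
  proof -
    have 1: "(?G has_real_derivative log_adjustment \<gamma> L (1 / \<kappa>) / (1 / \<kappa>)) (at (1 / \<kappa>))"
      using assms that by (intro iter_log_powr_has_real_derivative) (auto simp: field_simps)
    have 2: "((\<lambda>\<kappa>. 1 / \<kappa>) has_real_derivative - (1 / \<kappa>\<^sup>2)) (at \<kappa>)"
      using that by (auto intro!: derivative_eq_intros simp: power2_eq_square)
    have "(?F has_real_derivative - (log_adjustment \<gamma> L (1 / \<kappa>) / (1 / \<kappa>) * - (1 / \<kappa>\<^sup>2))) (at \<kappa>)"
      by (intro DERIV_minus DERIV_chain2[OF 1 2])
    then show ?thesis using that by (simp add: power2_eq_square)
  qed
  have lim0: "(?F \<longlongrightarrow> - 0) (at_right 0)"
  proof (intro tendsto_minus filterlim_compose[OF iter_log_powr_tendsto_0[OF assms(1)]])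
    show "filterlim (\<lambda>\<kappa>::real. 1 / \<kappa>) at_top (at_right 0)" by real_asymp
  qed
  have "isCont ?F (1/2)" by (rule DERIV_isCont[OF der]) auto
  then have lim1: "(?F \<longlongrightarrow> ?F (1/2)) (at_left (1/2))"
    by (simp add: isCont_def filterlim_at_split)
  have cont: "isCont ?f \<kappa>" if "0 < \<kappa>" "\<kappa> < 1/2" for \<kappa>
    using that by (intro continuous_intros isCont_o2[OF _ isCont_log_adjustment]) auto
  have nonneg: "0 \<le> ?f \<kappa>" if "0 < \<kappa>" "\<kappa> < 1/2" for \<kappa>
    using that by (intro divide_nonneg_nonneg less_imp_le[OF log_adjustment_pos]) auto
  note * = set_integral_FTC_Ioo[of 0 "1/2" ?F ?f, OF _ der cont nonneg lim0 lim1]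
  show "set_integrable lborel {0<..<1/2} ?f"
    by (rule *) auto
  show "(LINT \<kappa>:{0<..<1/2}|lborel. ?f \<kappa>) = iter_log L 2 powr - \<gamma> / \<gamma>"
    by (subst *) auto
qed

text \<open>Split at u = 1. Below it the density is at most \<open>u powr (a - 1)\<close>,
  integrable since a > 0; above it, at most 2 h(1 + u)/(1 + u), whose integral is known from the
  antiderivative.\<close>

lemma mixing_density_finite:
  fixes a b \<gamma> :: real
  assumes "0 < a" "0 \<le> b" "0 < \<gamma>" "1 \<le> L"
  shows "(\<integral>\<^sup>+u\<in>{0<..}. ennreal (u powr (a - 1) / (1 + u) powr (a + b) * log_adjustment \<gamma> L (1 + u)) \<partial>lborel) < \<infinity>"
proof -
  let ?h = "\<lambda>u. log_adjustment \<gamma> L (1 + u)"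
  let ?m = "\<lambda>u. u powr (a - 1) / (1 + u) powr (a + b) * ?h u"
  have small: "?m u \<le> u powr (a - 1)" if u: "0 < u" for u
  proof -
    have h: "0 < ?h u" "?h u \<le> 1"
      using u assms log_adjustment_pos[of "1 + u" \<gamma> L] log_adjustment_le_1[of \<gamma> "1 + u" L] by auto
    have "u powr (a - 1) / (1 + u) powr (a + b) \<le> u powr (a - 1)"
      using u assms ge_one_powr_ge_zero[of "1 + u" "a + b"] 
      by (auto simp: divide_le_eq mult_le_cancel_left1 intro: order_trans)
    then have "?m u \<le> u powr (a - 1) * 1"
      using h by (intro mult_mono) auto
    then show ?thesis by simp
  qed
  have large: "?m u \<le> 2 * (?h u / (1 + u))" if u: "1 \<le> u" for u
  proof -
    have h: "0 < ?h u" using u log_adjustment_pos[of "1 + u" \<gamma> L] by auto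
    have "u powr (a - 1) / (1 + u) powr (a + b) \<le> u powr (a - 1) / (1 + u) powr a"
      using u assms by (intro divide_left_mono powr_mono) auto
    \<comment> \<open>For u \<ge> 1 the quotient u/(1 + u) lies in [1/2, 1], so its power is at most
      2 whatever the sign of a - 1.\<close>
    also have "\<dots> = (u / (1 + u)) powr (a - 1) * (1 / (1 + u))"
      using u by (simp add: powr_divide powr_diff)
    also have "\<dots> \<le> 2 * (1 / (1 + u))"
      using u assms by (intro mult_right_mono powr_minus_one_bounds(2)) (auto simp: field_simps)
    finally have "?m u \<le> 2 * (1 / (1 + u)) * ?h u"
      using h by (intro mult_right_mono) auto
    then show ?thesis by simp
  qed
  have "(\<integral>\<^sup>+u\<in>{0<..}. ennreal (?m u) \<partial>lborel)
      \<le> (\<integral>\<^sup>+u. ennreal (u powr (a - 1)) * indicator {0<..<1} u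
            + 2 * (ennreal (?h u / (1 + u)) * indicator {1..} u) \<partial>lborel)"
  proof (intro nn_integral_mono)
    fix u :: real
    consider "u \<le> 0" | "0 < u" "u < 1" | "1 \<le> u" by linarith
    then show "ennreal (?m u) * indicator {0<..} u \<le> ennreal (u powr (a - 1)) * indicator {0<..<1} u
            + 2 * (ennreal (?h u / (1 + u)) * indicator {1..} u)"
    proof cases
      case 3
      then have "ennreal (?m u) \<le> ennreal (2 * (?h u / (1 + u)))"
        by (intro ennreal_leI large)
      also have "\<dots> = 2 * ennreal (?h u / (1 + u))"
        by (subst ennreal_mult') auto
      finally show ?thesis using 3 by simp
    qed (use small in \<open>auto intro: ennreal_leI\<close>)
  qed
  also have "\<dots> = (\<integral>\<^sup>+u\<in>{0<..<1}. ennreal (u powr (a - 1)) \<partial>lborel)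
      + 2 * (\<integral>\<^sup>+u\<in>{1..}. ennreal (?h u / (1 + u)) \<partial>lborel)"
    by (subst nn_integral_add) (auto simp: nn_integral_cmult)
  also have "\<dots> < \<infinity>"
    using nn_set_integral_eq_ennreal_set_integral[OF set_integrable_powr(1)[OF assms(1)]] assms
    by (simp add: nn_integral_log_adjustment_tail ennreal_mult_less_top)
  finally show ?thesis .
qed

text \<open>Tonelli: for each fixed u > 0 the inner integral in \<theta> is that of a normal density
  with standard deviation \<open>sqrt u\<close>, hence 1.\<close>

lemma nn_integral_ila_prior_kernel:
  "(\<integral>\<^sup>+\<theta>. ila_prior_kernel a b \<gamma> L \<theta> \<partial>lborel) =
   (\<integral>\<^sup>+u\<in>{0<..}. ennreal (u powr (a - 1) / (1 + u) powr (a + b) * log_adjustment \<gamma> L (1 + u)) \<partial>lborel)"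
proof -
  let ?m = "\<lambda>u. u powr (a - 1) / (1 + u) powr (a + b) * log_adjustment \<gamma> L (1 + u)"
  have "(\<integral>\<^sup>+\<theta>. ila_prior_kernel a b \<gamma> L \<theta> \<partial>lborel) = (\<integral>\<^sup>+\<theta>. \<integral>\<^sup>+u.
       ennreal (1 / sqrt (2 * pi * u) * exp (- (\<theta>\<^sup>2 / (2 * u))) * (u powr (a - 1) / (1 + u) powr (a + b))
         * log_adjustment \<gamma> L (1 + u)) * indicator {0<..} u \<partial>lborel \<partial>lborel)"
    by (simp add: ila_prior_kernel_def)
  also have "\<dots> = (\<integral>\<^sup>+u. \<integral>\<^sup>+\<theta>. 
       ennreal (1 / sqrt (2 * pi * u) * exp (- (\<theta>\<^sup>2 / (2 * u))) * (u powr (a - 1) / (1 + u) powr (a + b))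
         * log_adjustment \<gamma> L (1 + u)) * indicator {0<..} u \<partial>lborel \<partial>lborel)"
    by (rule lborel_pair.Fubini'[symmetric]) measurable
  also have "\<dots> = (\<integral>\<^sup>+u\<in>{0<..}. ennreal (?m u) \<partial>lborel)"
  proof (intro nn_integral_cong)
    fix u :: real
    show "(\<integral>\<^sup>+\<theta>. ennreal (1 / sqrt (2 * pi * u) * exp (- (\<theta>\<^sup>2 / (2 * u))) * (u powr (a - 1) / (1 + u) powr (a + b))
         * log_adjustment \<gamma> L (1 + u)) * indicator {0<..} u \<partial>lborel) = ennreal (?m u) * indicator {0<..} u"
    proof (cases "0 < u")
      case True
      have "(\<integral>\<^sup>+\<theta>. ennreal (1 / sqrt (2 * pi * u) * exp (- (\<theta>\<^sup>2 / (2 * u))) * (u powr (a - 1) / (1 + u) powr (a + b))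
         * log_adjustment \<gamma> L (1 + u)) * indicator {0<..} u \<partial>lborel)
         = (\<integral>\<^sup>+\<theta>. ennreal (normal_density 0 (sqrt u) \<theta>) * ennreal (?m u) \<partial>lborel)"
        using True by (intro nn_integral_cong)
          (simp add: normal_density_def ennreal_mult'[symmetric] mult.assoc)
      also have "\<dots> = (\<integral>\<^sup>+\<theta>. ennreal (normal_density 0 (sqrt u) \<theta>) \<partial>lborel) * ennreal (?m u)"
        by (intro nn_integral_multc) auto
      also have "(\<integral>\<^sup>+\<theta>. ennreal (normal_density 0 (sqrt u) \<theta>) \<partial>lborel) = 1"
        using True by (subst nn_integral_eq_integral) auto
      finally show ?thesis using True by simp
    qed simp
  qed
  finally show ?thesis .
qed

lemma nn_integral_ila_prior_kernel_less_top:
  assumes "0 < a" "0 \<le> b" "0 < \<gamma>" "1 \<le> L"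
  shows "(\<integral>\<^sup>+\<theta>. ila_prior_kernel a b \<gamma> L \<theta> \<partial>lborel) < \<infinity>"
  unfolding nn_integral_ila_prior_kernel using mixing_density_finite[OF assms] .

lemma nn_integral_ila_prior_kernel_pos:
  "0 < (\<integral>\<^sup>+\<theta>. ila_prior_kernel a b \<gamma> L \<theta> \<partial>lborel)"
  unfolding nn_integral_ila_prior_kernel
proof (rule nn_integral_pos[of _ 0 1])
  show "0 < ennreal (u powr (a - 1) / (1 + u) powr (a + b) * log_adjustment \<gamma> L (1 + u)) * indicator {0<..} u"
    if "0 < u" for u
    using that log_adjustment_pos[of "1 + u" \<gamma> L] by simp
qed auto

subsection \<open>Behaviour of the prior at the origin and in the tails\<close>

lemma ila_prior_kernel_tendsto_top:
  assumes "0 < a" "a \<le> 1/2" "0 \<le> b" "0 < \<gamma>"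
  shows "(ila_prior_kernel a b \<gamma> L \<longlongrightarrow> \<infinity>) (at 0)"
proof -
  \<comment> \<open>The constant collects lower bounds, valid for
    \<open>\<theta>\<^sup>2 \<le> u \<le> 1\<close>, of all factors of the integrand other than
    \<open>1 / sqrt u * u powr (a - 1)\<close>.\<close>
  define c where "c = 1 / sqrt (2 * pi) * exp (- (1/2)) * (1 / 2 powr (a + b)) * log_adjustment \<gamma> L 2"
  have c: "0 < c" unfolding c_def using log_adjustment_pos[of 2 \<gamma> L] by simp
  have lower: "ennreal (c * - ln (\<theta>\<^sup>2)) \<le> ila_prior_kernel a b \<gamma> L \<theta>" if \<theta>: "\<theta> \<noteq> 0" "\<bar>\<theta>\<bar> < 1" for \<theta>
  proof -
    have \<theta>2: "0 < \<theta>\<^sup>2" "\<theta>\<^sup>2 \<le> 1" using \<theta> by (auto simp: abs_square_le_1)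
    have "(\<integral>\<^sup>+u\<in>{\<theta>\<^sup>2..1}. ennreal (c * (1 / u)) \<partial>lborel) = ennreal (c * ln 1 - c * ln (\<theta>\<^sup>2))"
    proof (rule nn_integral_FTC_Icc[where F = "\<lambda>u. c * ln u"])
      show "((\<lambda>u. c * ln u) has_real_derivative c * (1 / u)) (at u)" "0 \<le> c * (1 / u)"
        if "u \<in> {\<theta>\<^sup>2..1}" for u
        using less_le_trans[OF \<theta>2(1), of u] that c by (auto intro!: derivative_eq_intros)
    qed (use \<theta>2 in auto)
    moreover have "(\<integral>\<^sup>+u\<in>{\<theta>\<^sup>2..1}. ennreal (c * (1 / u)) \<partial>lborel) \<le> ila_prior_kernel a b \<gamma> L \<theta>"
      unfolding ila_prior_kernel_def
    proof (intro nn_integral_mono)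
      fix u :: real
      show "ennreal (c * (1 / u)) * indicator {\<theta>\<^sup>2..1} u \<le> ennreal (1 / sqrt (2 * pi * u) * exp (- (\<theta>\<^sup>2 / (2 * u)))
          * (u powr (a - 1) / (1 + u) powr (a + b)) * log_adjustment \<gamma> L (1 + u)) * indicator {0<..} u"
      proof (cases "u \<in> {\<theta>\<^sup>2..1}")
        case True
        then have u: "0 < u" "u \<le> 1" "\<theta>\<^sup>2 \<le> u"
          using less_le_trans[OF \<theta>2(1), of u] by auto
        have "exp (- (1/2)) \<le> exp (- (\<theta>\<^sup>2 / (2 * u)))" using u by (simp add: field_simps)
        \<comment> \<open>This is where a \<le> 1/2 enters: then a - 3/2 \<le> -1, and for u \<le> 1
          a smaller exponent gives a larger power.\<close>
        moreover have "1 / u \<le> 1 / sqrt u * u powr (a - 1)"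
        proof -
          have "1 / sqrt u * u powr (a - 1) = u powr (a - 3/2)"
            using u powr_add[of u "-(1/2)" "a - 1"]
            by (simp add: powr_minus_divide powr_half_sqrt)
          moreover have "u powr (- 1) \<le> u powr (a - 3/2)"
            using u assms by (intro powr_mono') auto
          ultimately show ?thesis using u by (simp add: powr_minus_divide)
        qed
        moreover have "1 / 2 powr (a + b) \<le> 1 / (1 + u) powr (a + b)"
          using u assms by (intro divide_left_mono powr_mono2) auto
        moreover have "log_adjustment \<gamma> L 2 \<le> log_adjustment \<gamma> L (1 + u)"
          using u assms by (intro log_adjustment_antimono) auto
        ultimately have "1 / sqrt (2 * pi) * exp (- (1/2)) * (1 / 2 powr (a + b)) * log_adjustment \<gamma> L 2 * (1 / u)
            \<le> 1 / sqrt (2 * pi) * exp (- (\<theta>\<^sup>2 / (2 * u))) * (1 / (1 + u) powr (a + b)) * log_adjustment \<gamma> L (1 + u)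
              * (1 / sqrt u * u powr (a - 1))"
          using u log_adjustment_pos[of 2 \<gamma> L] log_adjustment_pos[of "1 + u" \<gamma> L]
          by (intro mult_mono order_refl) auto
        also have "\<dots> = 1 / sqrt (2 * pi * u) * exp (- (\<theta>\<^sup>2 / (2 * u)))
          * (u powr (a - 1) / (1 + u) powr (a + b)) * log_adjustment \<gamma> L (1 + u)"
          by (simp add: real_sqrt_mult mult_ac)
        finally have "c * (1 / u) \<le> \<dots>" by (simp add: c_def)
        then show ?thesis using u True by (simp add: ennreal_leI)
      qed simp
    qed
    ultimately show ?thesis by simp
  qed
  have "filterlim (\<lambda>\<theta>. c * - ln (\<theta>\<^sup>2)) at_top (at (0::real))"
    using c by real_asymp
  then have *: "((\<lambda>\<theta>. ennreal (c * - ln (\<theta>\<^sup>2))) \<longlongrightarrow> \<infinity>) (at 0)"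
    by (simp only: ennreal_tendsto_top_eq_at_top infinity_ennreal_def)
  show ?thesis
  proof (rule tendsto_sandwich[OF _ _ * tendsto_const])
    show "\<forall>\<^sub>F \<theta> in at 0. ennreal (c * - ln (\<theta>\<^sup>2)) \<le> ila_prior_kernel a b \<gamma> L \<theta>"
      unfolding eventually_at using lower by (intro exI[of _ 1]) (auto simp: dist_real_def)
  qed simp
qed

lemma ila_prior_tendsto_top:
  assumes "0 < a" "a \<le> 1/2" "0 \<le> b" "0 < \<gamma>" "1 \<le> L"
  shows "(ila_prior a b \<gamma> L \<longlongrightarrow> \<infinity>) (at 0)"
proof -
  let ?N = "\<integral>\<^sup>+\<theta>. ila_prior_kernel a b \<gamma> L \<theta> \<partial>lborel"
  have N: "?N < \<infinity>" "0 < ?N"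
    using nn_integral_ila_prior_kernel_less_top[OF assms(1,3-5)] nn_integral_ila_prior_kernel_pos by auto
  have "((\<lambda>\<theta>. ila_prior_kernel a b \<gamma> L \<theta> * inverse ?N) \<longlongrightarrow> \<infinity> * inverse ?N) (at 0)"
    using ila_prior_kernel_tendsto_top[OF assms(1-4)] N
    by (intro tendsto_mult_ennreal tendsto_const) auto
  \<comment> \<open>Finiteness of \<open>?N\<close> makes its inverse nonzero, so the infinite limit
    survives normalization.\<close>
  moreover have "\<infinity> * inverse ?N = \<infinity>"
    using N by (simp add: ennreal_top_mult)
  ultimately show ?thesis
    unfolding ila_prior_def normalized_def[abs_def] divide_ennreal_def by simp
qed

section \<open>Tail asymptotics by scaling and dominated convergence\<close>

lemma powr_times_exp_le:
  fixes p y :: real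
  assumes "0 < p" "0 < y"
  shows "y powr p * exp (- (y / 2)) \<le> (2 * p) powr p"
proof -
  \<comment> \<open>The maximum of the left-hand side is at y = 2p. The tangent bound ln t \<le> t -
    1 at t = y/(2p) gives it; discarding the resulting -p loses only a factor exp (-p).\<close>
  have "ln (y / (2 * p)) \<le> y / (2 * p) - 1"
    using assms by (intro ln_le_minus_one) auto
  then have "p * (ln y - ln (2 * p)) \<le> p * (y / (2 * p) - 1)"
    using assms by (intro mult_left_mono) (auto simp: ln_div)
  also have "\<dots> \<le> y / 2" using assms by (simp add: field_simps)
  finally have "p * ln y + (- (y / 2)) \<le> p * ln (2 * p)" by (simp add: algebra_simps)
  then have "exp (p * ln y + (- (y / 2))) \<le> exp (p * ln (2 * p))" by simp
  then show ?thesis using assms by (simp add: powr_def exp_add[symmetric])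
qed

text \<open>The kernel at \<open>\<theta>\<close> after the substitution \<open>u = \<theta>\<^sup>2 s\<close>, with the factor
  \<open>\<theta> powr (- 2 * b - 1) * log_adjustment \<gamma> L (1 + \<theta>\<^sup>2) / sqrt (2 * pi)\<close> removed.\<close>

definition scaled_integrand :: "real \<Rightarrow> real \<Rightarrow> real \<Rightarrow> nat \<Rightarrow> real \<Rightarrow> real \<Rightarrow> real" where
  "scaled_integrand a b \<gamma> L \<theta> s = indicator {0<..} s *
     (s powr (a - 3/2) * exp (- (1 / s / 2)) * (s + 1 / \<theta>\<^sup>2) powr (- (a + b))
       * (log_adjustment \<gamma> L (1 + \<theta>\<^sup>2 * s) / log_adjustment \<gamma> L (1 + \<theta>\<^sup>2)))"

text \<open>Pointwise limit of \<open>scaled_integrand\<close> as \<theta> tends to infinity: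
  1/\<theta>^2 disappears, the log ratio tends to 1, and the two powers of s combine so that a
  cancels.\<close>

definition limit_integrand :: "real \<Rightarrow> real \<Rightarrow> real" where
  "limit_integrand b s = indicator {0<..} s * (s powr (- (b + 3/2)) * exp (- (1 / s / 2)))"

text \<open>The constant on (0, 1) is the bound of \<open>powr_times_exp_le\<close> with y = 1/s;
  the power beyond 1 is the worst case b = 0. Nothing depends on \<theta>.\<close>

definition dominating_integrand :: "real \<Rightarrow> real \<Rightarrow> real" where
  "dominating_integrand p s =
     indicator {0<..<1} s * (2 * p) powr p + indicator {1..} s * s powr (- 3/2)"

lemma measurable_integrands [measurable]:
  "scaled_integrand a b \<gamma> L \<theta> \<in> borel_measurable borel"
  "limit_integrand b \<in> borel_measurable borel"
  unfolding scaled_integrand_def[abs_def] limit_integrand_def[abs_def] by measurable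

lemma powr_mult_powr_cancel:
  fixes s a b :: real
  shows "s powr (a - 3/2) * s powr (- (a + b)) = s powr (- (b + 3/2))"
proof -
  have "s powr (a - 3/2) * s powr (- (a + b)) = s powr (a - 3/2 + - (a + b))"
    by (simp only: powr_add)
  also have "a - 3/2 + - (a + b) = - (b + 3/2)" by simp
  finally show ?thesis .
qed

lemma scaled_integrand_nonneg: "0 \<le> scaled_integrand a b \<gamma> L \<theta> s"
  unfolding scaled_integrand_def
  by (auto simp: indicator_def intro!: mult_nonneg_nonneg divide_nonneg_nonneg less_imp_le[OF log_adjustment_pos])

lemma integrable_dominating_integrand: "integrable lborel (dominating_integrand p)"
  unfolding dominating_integrand_def[abs_def]
proof (rule Bochner_Integration.integrable_add)
  show "integrable lborel (\<lambda>s::real. indicator {0<..<1} s * (2 * p) powr p)"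
    by (intro integrable_mult_left) (simp add: integrable_indicator_iff)
  \<comment> \<open>The improper gauge integral becomes absolute by nonnegativity; Borel
    measurability then brings it from the completed measure back to \<open>lborel\<close>.\<close>
  have "(\<lambda>s. s powr (- 3/2)) integrable_on {1::real..}"
    using has_integral_powr_to_inf[of "- 3/2" 1] by (auto simp: integrable_on_def)
  then have "(\<lambda>s. s powr (- 3/2)) absolutely_integrable_on {1::real..}"
    by (intro nonnegative_absolutely_integrable_1) auto
  then have "integrable lebesgue (\<lambda>s::real. indicator {1..} s * s powr (- 3/2))"
    by (simp add: set_integrable_def)
  then show "integrable lborel (\<lambda>s::real. indicator {1..} s * s powr (- 3/2))"
    by (subst (asm) integrable_completion) auto
qed

text \<open>For s < 1 the log ratio may exceed 1 but is at most (1/s) powr (L + \<gamma>); the total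
  negative power of s is then tamed by the exponential. For s \<ge> 1 both the log ratio and the
  exponential are at most 1.\<close>

lemma scaled_integrand_le:
  assumes "0 < a" "0 \<le> b" "0 < \<gamma>" "1 \<le> L" "0 < \<theta>"
  shows "scaled_integrand a b \<gamma> L \<theta> s \<le> dominating_integrand (b + 3/2 + (L + \<gamma>)) s"
proof -
  let ?h = "log_adjustment \<gamma> L"
  let ?p = "b + 3/2 + (L + \<gamma>)"
  consider "s \<le> 0" | "0 < s" "s < 1" | "1 \<le> s" by linarith
  then show ?thesis
  proof cases
    case 1
    then show ?thesis by (simp add: scaled_integrand_def dominating_integrand_def)
  next
    case 2
    have x: "1 \<le> 1 + \<theta>\<^sup>2 * s" "1 + \<theta>\<^sup>2 * s \<le> 1 + \<theta>\<^sup>2"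
      using 2 by (auto simp: mult_left_le)
    have pos: "0 < ?h (1 + \<theta>\<^sup>2)" "0 < ?h (1 + \<theta>\<^sup>2 * s)" using x by (auto intro!: log_adjustment_pos)
    have "?h (1 + \<theta>\<^sup>2 * s) / ?h (1 + \<theta>\<^sup>2) \<le> ((1 + \<theta>\<^sup>2) / (1 + \<theta>\<^sup>2 * s)) powr (L + \<gamma>)"
      using log_adjustment_le_scaled[OF assms(3) x assms(4)] pos by (simp add: divide_le_eq)
    also have "\<dots> \<le> (1 / s) powr (L + \<gamma>)"
    proof -
      have "(1 + \<theta>\<^sup>2) * s \<le> 1 + \<theta>\<^sup>2 * s" using 2 by (simp add: algebra_simps)
      then have "1 + \<theta>\<^sup>2 \<le> 1 / s * (1 + \<theta>\<^sup>2 * s)" using 2 by (simp add: pos_le_divide_eq)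
      then have "(1 + \<theta>\<^sup>2) / (1 + \<theta>\<^sup>2 * s) \<le> 1 / s" using x by (subst pos_divide_le_eq) auto
      then show ?thesis using assms x by (intro powr_mono2) auto
    qed
    finally have ratio: "?h (1 + \<theta>\<^sup>2 * s) / ?h (1 + \<theta>\<^sup>2) \<le> (1 / s) powr (L + \<gamma>)" .
    \<comment> \<open>The exponent -(a + b) is negative, so dropping 1/\<theta>^2 can only enlarge
      the power.\<close>
    have "(s + 1 / \<theta>\<^sup>2) powr (- (a + b)) \<le> s powr (- (a + b))"
      using 2 assms by (intro powr_mono2') auto
    then have "s powr (a - 3/2) * exp (- (1 / s / 2)) * (s + 1 / \<theta>\<^sup>2) powr (- (a + b))
          * (?h (1 + \<theta>\<^sup>2 * s) / ?h (1 + \<theta>\<^sup>2))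
        \<le> s powr (a - 3/2) * exp (- (1 / s / 2)) * s powr (- (a + b)) * (1 / s) powr (L + \<gamma>)"
      using pos by (intro mult_mono ratio order_refl mult_nonneg_nonneg divide_nonneg_nonneg) auto
    then have "scaled_integrand a b \<gamma> L \<theta> s \<le>
        s powr (a - 3/2) * exp (- (1 / s / 2)) * s powr (- (a + b)) * (1 / s) powr (L + \<gamma>)"
      using 2 by (simp add: scaled_integrand_def)
    also have "\<dots> = s powr (a - 3/2) * s powr (- (a + b)) * (1 / s) powr (L + \<gamma>) * exp (- (1 / s / 2))"
      by simp
    also have "s powr (a - 3/2) * s powr (- (a + b)) * (1 / s) powr (L + \<gamma>) = (1 / s) powr ?p"
    proof -
      have "s powr (a - 3/2) * s powr (- (a + b)) = (1 / s) powr (b + 3/2)"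
        unfolding powr_mult_powr_cancel using 2 by (simp only: powr_minus_divide powr_divide powr_one_eq_one)
      then show ?thesis by (simp add: powr_add)
    qed
    also have "(1 / s) powr ?p * exp (- (1 / s / 2)) \<le> (2 * ?p) powr ?p"
      using 2 assms by (intro powr_times_exp_le) auto
    finally show ?thesis using 2 by (simp add: dominating_integrand_def)
  next
    case 3
    have x: "1 + \<theta>\<^sup>2 \<le> 1 + \<theta>\<^sup>2 * s"
      using 3 by (simp add: mult_le_cancel_left1)
    have pos: "0 < ?h (1 + \<theta>\<^sup>2)" "0 < ?h (1 + \<theta>\<^sup>2 * s)" using 3 by (auto intro!: log_adjustment_pos)
    have ratio: "?h (1 + \<theta>\<^sup>2 * s) / ?h (1 + \<theta>\<^sup>2) \<le> 1"
      using log_adjustment_antimono[OF assms(3) _ x] pos by simp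
    have "(s + 1 / \<theta>\<^sup>2) powr (- (a + b)) \<le> s powr (- (a + b))"
      using 3 assms by (intro powr_mono2') auto
    then have "s powr (a - 3/2) * exp (- (1 / s / 2)) * (s + 1 / \<theta>\<^sup>2) powr (- (a + b))
          * (?h (1 + \<theta>\<^sup>2 * s) / ?h (1 + \<theta>\<^sup>2))
        \<le> s powr (a - 3/2) * 1 * s powr (- (a + b)) * 1"
      using pos 3 by (intro mult_mono ratio order_refl mult_nonneg_nonneg divide_nonneg_nonneg) auto
    then have "scaled_integrand a b \<gamma> L \<theta> s \<le> s powr (a - 3/2) * 1 * s powr (- (a + b)) * 1"
      using 3 by (simp add: scaled_integrand_def)
    also have "\<dots> = s powr (- (b + 3/2))"
      using powr_mult_powr_cancel[of s a b] by simp
    also have "\<dots> \<le> s powr (- 3/2)"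
      using 3 assms by (intro powr_mono) auto
    finally show ?thesis using 3 by (simp add: dominating_integrand_def)
  qed
qed

lemma integrable_scaled_integrand:
  assumes "0 < a" "0 \<le> b" "0 < \<gamma>" "1 \<le> L" "0 < \<theta>"
  shows "integrable lborel (scaled_integrand a b \<gamma> L \<theta>)"
  by (rule Bochner_Integration.integrable_bound[OF integrable_dominating_integrand])
    (use scaled_integrand_le[OF assms] scaled_integrand_nonneg in \<open>auto intro!: order_trans[OF _ abs_ge_self]\<close>)

text \<open>The number 1 + M^2 s lies between 1 + M^2 and (1 + M^2) s, so the logarithms differ by
  at most |ln s| uniformly in M. This serves both the slow variation of \<ell> and the pointwise
  limit of the integrand.\<close>

lemma log_adjustment_square_ratio_tendsto:
  assumes "0 < s" "1 \<le> L"
  shows "((\<lambda>M. log_adjustment \<gamma> L (1 + M\<^sup>2 * s) / log_adjustment \<gamma> L (1 + M\<^sup>2)) \<longlongrightarrow> 1) at_top"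
proof (rule log_adjustment_ratio_tendsto[OF _ _ _ _ assms(2), where K = "\<bar>ln s\<bar>"])
  show "filterlim (\<lambda>M::real. 1 + M\<^sup>2) at_top at_top" by real_asymp
  fix M :: real
  have p: "0 < 1 + M\<^sup>2" "0 < 1 + M\<^sup>2 * s" using assms by (auto simp: add_pos_nonneg)
  then have *: "ln (1 + M\<^sup>2) + ln s = ln ((1 + M\<^sup>2) * s)"
    using assms by (subst ln_mult) auto
  show "\<bar>ln (1 + M\<^sup>2 * s) - ln (1 + M\<^sup>2)\<bar> \<le> \<bar>ln s\<bar>"
  proof (cases "1 \<le> s")
    case True
    then have "1 + M\<^sup>2 \<le> 1 + M\<^sup>2 * s" "1 + M\<^sup>2 * s \<le> (1 + M\<^sup>2) * s"
      using mult_left_mono[of 1 s "M\<^sup>2"] by (auto simp: algebra_simps)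
    then have "ln (1 + M\<^sup>2) \<le> ln (1 + M\<^sup>2 * s)" "ln (1 + M\<^sup>2 * s) \<le> ln ((1 + M\<^sup>2) * s)"
      using p by auto
    then show ?thesis using * by linarith
  next
    case False
    then have "1 + M\<^sup>2 * s \<le> 1 + M\<^sup>2" "(1 + M\<^sup>2) * s \<le> 1 + M\<^sup>2 * s"
      using mult_left_mono[of s 1 "M\<^sup>2"] by (auto simp: algebra_simps)
    then have "ln (1 + M\<^sup>2 * s) \<le> ln (1 + M\<^sup>2)" "ln ((1 + M\<^sup>2) * s) \<le> ln (1 + M\<^sup>2 * s)"
      using p assms by auto
    then show ?thesis using * by linarith
  qed
qed (use assms in auto)

lemma integral_scaled_integrand_tendsto:
  assumes "0 < a" "0 \<le> b" "0 < \<gamma>" "1 \<le> L"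
  shows "((\<lambda>\<theta>. LINT s|lborel. scaled_integrand a b \<gamma> L \<theta> s) \<longlongrightarrow> (LINT s|lborel. limit_integrand b s)) at_top"
    and "integrable lborel (limit_integrand b)"
proof -
  let ?w = "dominating_integrand (b + 3/2 + (L + \<gamma>))"
  have lim: "((\<lambda>\<theta>. scaled_integrand a b \<gamma> L \<theta> s) \<longlongrightarrow> limit_integrand b s) at_top" for s
  proof (cases "0 < s")
    case True
    have "((\<lambda>\<theta>::real. s + 1 / \<theta>\<^sup>2) \<longlongrightarrow> s) at_top" by real_asymp
    then have "((\<lambda>\<theta>. scaled_integrand a b \<gamma> L \<theta> s) \<longlongrightarrow>
        1 * (s powr (a - 3/2) * exp (- (1 / s / 2)) * s powr (- (a + b)) * 1)) at_top"
      unfolding scaled_integrand_def using True assms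
      by (intro tendsto_mult tendsto_const tendsto_powr log_adjustment_square_ratio_tendsto) auto
    also have "1 * (s powr (a - 3/2) * exp (- (1 / s / 2)) * s powr (- (a + b)) * 1) = limit_integrand b s"
      using powr_mult_powr_cancel[of s a b] True by (simp add: limit_integrand_def mult_ac)
    finally show ?thesis .
  qed (simp add: scaled_integrand_def limit_integrand_def)
  \<comment> \<open>Domination is available only for \<theta> > 0, which holds eventually.\<close>
  have bound: "\<forall>\<^sub>F \<theta> in at_top. AE s in lborel. norm (scaled_integrand a b \<gamma> L \<theta> s) \<le> ?w s"
    using eventually_gt_at_top[of 0]
    by eventually_elim (use scaled_integrand_le[OF assms] scaled_integrand_nonneg in auto)
  have meas: "limit_integrand b \<in> borel_measurable lborel"
    "\<And>\<theta>. scaled_integrand a b \<gamma> L \<theta> \<in> borel_measurable lborel" by simp_all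
  show "((\<lambda>\<theta>. LINT s|lborel. scaled_integrand a b \<gamma> L \<theta> s) \<longlongrightarrow> (LINT s|lborel. limit_integrand b s)) at_top"
    by (rule integral_dominated_convergence_at_top[OF meas integrable_dominating_integrand AE_I2[OF lim] bound])
  show "integrable lborel (limit_integrand b)"
    by (rule integrable_dominated_convergence_at_top[OF meas integrable_dominating_integrand AE_I2[OF lim] bound])
qed

lemma integral_limit_integrand_pos:
  assumes "integrable lborel (limit_integrand b)"
  shows "0 < (LINT s|lborel. limit_integrand b s)"
proof -
  have "0 < (\<integral>\<^sup>+s. ennreal (limit_integrand b s) \<partial>lborel)"
    by (rule nn_integral_pos[of _ 0 1]) (auto simp: limit_integrand_def)
  also have "\<dots> = ennreal (LINT s|lborel. limit_integrand b s)"
    by (intro nn_integral_eq_integral assms AE_I2) (simp add: limit_integrand_def)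
  finally show ?thesis by simp
qed

text \<open>Substitution u = \<theta>^2 s. The Jacobian, 1/sqrt u and the two powers contribute the
  exponents 2, -1, 2(a - 1) and -2(a + b) of \<theta>, whose sum is -2b - 1.\<close>

lemma ila_prior_kernel_eq_scaled:
  assumes "0 < a" "0 \<le> b" "0 < \<gamma>" "1 \<le> L" "0 < \<theta>"
  shows "ila_prior_kernel a b \<gamma> L \<theta> = ennreal (1 / sqrt (2 * pi) * \<theta> powr (- 2 * b - 1)
     * log_adjustment \<gamma> L (1 + \<theta>\<^sup>2) * (LINT s|lborel. scaled_integrand a b \<gamma> L \<theta> s))"
proof -
  let ?h = "log_adjustment \<gamma> L"
  let ?C = "1 / sqrt (2 * pi) * \<theta> powr (- 2 * b - 1) * ?h (1 + \<theta>\<^sup>2)"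
  let ?g = "\<lambda>u. 1 / sqrt (2 * pi * u) * exp (- (\<theta>\<^sup>2 / (2 * u))) * (u powr (a - 1) / (1 + u) powr (a + b)) * ?h (1 + u)"
  have pos: "0 < ?h (1 + \<theta>\<^sup>2)" by (intro log_adjustment_pos) auto
  have scale: "\<theta>\<^sup>2 * ?g (\<theta>\<^sup>2 * s) = ?C * scaled_integrand a b \<gamma> L \<theta> s" if s: "0 < s" for s
  proof -
    have 1: "1 + \<theta>\<^sup>2 * s = \<theta>\<^sup>2 * (s + 1 / \<theta>\<^sup>2)" using assms by (simp add: field_simps)
    have 2: "(1 + \<theta>\<^sup>2 * s) powr (a + b) = (\<theta>\<^sup>2) powr (a + b) * (s + 1 / \<theta>\<^sup>2) powr (a + b)"
      unfolding 1 using s assms by (subst powr_mult) auto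
    have 3: "(\<theta>\<^sup>2 * s) powr (a - 1) = (\<theta>\<^sup>2) powr (a - 1) * s powr (a - 1)"
      using s assms by (subst powr_mult) auto
    have 4: "sqrt (2 * pi * (\<theta>\<^sup>2 * s)) = sqrt (2 * pi) * (\<theta> * s powr (1/2))"
      using s assms by (simp add: real_sqrt_mult powr_half_sqrt)
    have 5: "\<theta>\<^sup>2 / (2 * (\<theta>\<^sup>2 * s)) = 1 / s / 2" using s assms by simp
    have 6: "(\<theta>\<^sup>2) powr r = \<theta> powr (2 * r)" for r
    proof -
      have "\<theta> powr 2 = \<theta>\<^sup>2" using assms by (simp add: powr_numeral)
      then show ?thesis by (metis powr_powr)
    qed
    have 7: "\<theta>\<^sup>2 * (1 / \<theta> * (\<theta> powr (2 * (a - 1)) / \<theta> powr (2 * (a + b)))) = \<theta> powr (- 2 * b - 1)"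
    proof -
      have "\<theta>\<^sup>2 * (1 / \<theta> * (\<theta> powr (2 * (a - 1)) / \<theta> powr (2 * (a + b))))
          = \<theta> powr 2 * (\<theta> powr (- 1) * \<theta> powr (2 * (a - 1) - 2 * (a + b)))"
      proof -
        have "\<theta>\<^sup>2 = \<theta> powr 2" "1 / \<theta> = \<theta> powr (- 1)"
          using assms by (simp_all add: powr_numeral powr_minus_divide)
        then show ?thesis by (simp only: powr_diff)
      qed
      also have "\<dots> = \<theta> powr (2 + (- 1 + (2 * (a - 1) - 2 * (a + b))))"
        by (simp only: powr_add)
      also have "2 + (- 1 + (2 * (a - 1) - 2 * (a + b))) = - 2 * b - 1" by simp
      finally show ?thesis .
    qed
    have 8: "s powr (a - 1) / s powr (1/2) = s powr (a - 3/2)"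
      by (simp add: powr_diff[symmetric])
    have "\<theta>\<^sup>2 * ?g (\<theta>\<^sup>2 * s) = 1 / sqrt (2 * pi)
        * (\<theta>\<^sup>2 * (1 / \<theta> * (\<theta> powr (2 * (a - 1)) / \<theta> powr (2 * (a + b)))))
        * ((s powr (a - 1) / s powr (1/2)) * exp (- (1 / s / 2)) * (1 / (s + 1 / \<theta>\<^sup>2) powr (a + b))) * ?h (1 + \<theta>\<^sup>2 * s)"
      unfolding 2 3 4 5 6 by (simp add: field_simps)
    also have "\<dots> = ?C * scaled_integrand a b \<gamma> L \<theta> s"
      unfolding 7 8 scaled_integrand_def using s pos by (simp only: powr_minus_divide) simp
    finally show ?thesis .
  qed
  have "ila_prior_kernel a b \<gamma> L \<theta> = (\<integral>\<^sup>+u. ennreal (?g u) * indicator {0<..} u \<partial>lborel)"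
    by (simp add: ila_prior_kernel_def)
  also have "\<dots> = ennreal \<bar>\<theta>\<^sup>2\<bar> * (\<integral>\<^sup>+s. ennreal (?g (0 + \<theta>\<^sup>2 * s)) * indicator {0<..} (0 + \<theta>\<^sup>2 * s) \<partial>lborel)"
    using assms by (intro nn_integral_real_affine) auto
  also have "\<dots> = (\<integral>\<^sup>+s. ennreal \<bar>\<theta>\<^sup>2\<bar> * (ennreal (?g (0 + \<theta>\<^sup>2 * s)) * indicator {0<..} (0 + \<theta>\<^sup>2 * s)) \<partial>lborel)"
    by (intro nn_integral_cmult[symmetric]) measurable
  also have "\<dots> = (\<integral>\<^sup>+s. ennreal (?C * scaled_integrand a b \<gamma> L \<theta> s) \<partial>lborel)"
  proof (intro nn_integral_cong)
    fix s :: real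
    show "ennreal \<bar>\<theta>\<^sup>2\<bar> * (ennreal (?g (0 + \<theta>\<^sup>2 * s)) * indicator {0<..} (0 + \<theta>\<^sup>2 * s))
       = ennreal (?C * scaled_integrand a b \<gamma> L \<theta> s)"
    proof (cases "0 < s")
      case True
      have "ennreal \<bar>\<theta>\<^sup>2\<bar> * ennreal (?g (\<theta>\<^sup>2 * s)) = ennreal (\<theta>\<^sup>2 * ?g (\<theta>\<^sup>2 * s))"
        by (subst ennreal_mult') auto
      then show ?thesis using True assms scale[OF True] by simp
    next
      case False
      \<comment> \<open>For s \<le> 0 the indicators make both sides vanish, since scaling by
        \<theta>^2 > 0 preserves the sign.\<close>
      then have "\<not> 0 < \<theta>\<^sup>2 * s" by (simp add: zero_less_mult_iff)
      then show ?thesis using False by (simp add: scaled_integrand_def)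
    qed
  qed
  also have "\<dots> = ennreal (LINT s|lborel. ?C * scaled_integrand a b \<gamma> L \<theta> s)"
    using pos by (intro nn_integral_eq_integral integrable_mult_right integrable_scaled_integrand assms AE_I2
        mult_nonneg_nonneg scaled_integrand_nonneg) auto
  also have "\<dots> = ennreal (?C * (LINT s|lborel. scaled_integrand a b \<gamma> L \<theta> s))"
    by (subst integral_mult_right_zero) simp
  finally show ?thesis .
qed

lemma ila_prior_tail:
  assumes "0 < a" "0 \<le> b" "0 < \<gamma>" "1 \<le> L"
  shows "\<exists>c>0. \<exists>l. slowly_varying l \<and>
     ((\<lambda>\<theta>. enn2real (ila_prior a b \<gamma> L \<theta>) / (c * \<bar>\<theta>\<bar> powr (- 2 * b - 1) * l \<bar>\<theta>\<bar>)) \<longlongrightarrow> 1) at_infinity"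
proof -
  define l where "l M = log_adjustment \<gamma> L (1 + M\<^sup>2)" for M
  define J where "J \<theta> = (LINT s|lborel. scaled_integrand a b \<gamma> L \<theta> s)" for \<theta>
  define I where "I = (LINT s|lborel. limit_integrand b s)"
  have J: "(J \<longlongrightarrow> I) at_top" "0 < I"
    unfolding J_def I_def
    using integral_scaled_integrand_tendsto[OF assms] integral_limit_integrand_pos by auto
  have l_pos: "0 < l M" for M unfolding l_def by (intro log_adjustment_pos) simp
  obtain n where n: "(\<integral>\<^sup>+\<theta>. ila_prior_kernel a b \<gamma> L \<theta> \<partial>lborel) = ennreal n" "0 < n"
    using nn_integral_ila_prior_kernel_less_top[OF assms] nn_integral_ila_prior_kernel_pos[of a b \<gamma> L]
    by (cases "\<integral>\<^sup>+\<theta>. ila_prior_kernel a b \<gamma> L \<theta> \<partial>lborel") auto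
  \<comment> \<open>Chosen so that for \<theta> \<noteq> 0 the ratio in the claim is exactly
    \<open>J \<bar>\<theta>\<bar> / I\<close>.\<close>
  define c where "c = 1 / sqrt (2 * pi) * I / n"
  have c: "0 < c" using J n by (simp add: c_def)
  have J_nonneg: "0 \<le> J \<theta>" for \<theta>
    unfolding J_def by (intro integral_nonneg_AE AE_I2 scaled_integrand_nonneg)
  have "slowly_varying l"
    unfolding slowly_varying_def
  proof (intro conjI allI impI l_pos)
    fix v :: real assume "0 < v"
    \<comment> \<open>Since (M v)^2 = M^2 v^2, slow variation is the square-ratio limit at s =
      v^2.\<close>
    then show "((\<lambda>M. l (M * v) / l M) \<longlongrightarrow> 1) at_top"
      using log_adjustment_square_ratio_tendsto[of "v\<^sup>2" L \<gamma>] assms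
      by (simp add: l_def power_mult_distrib)
  qed
  moreover have "((\<lambda>\<theta>. enn2real (ila_prior a b \<gamma> L \<theta>) / (c * \<bar>\<theta>\<bar> powr (- 2 * b - 1) * l \<bar>\<theta>\<bar>)) \<longlongrightarrow> 1) at_infinity"
  proof -
    have "((\<lambda>\<theta>. J \<theta> / I) \<longlongrightarrow> I / I) at_top"
      using J by (intro tendsto_intros) auto
    then have "((\<lambda>\<theta>. J \<theta> / I) \<longlongrightarrow> 1) at_top" using J by simp
    \<comment> \<open>The kernel depends on \<theta> only through its square, so passing to the norm
      covers both tails at once.\<close>
    then have *: "((\<lambda>\<theta>::real. J (norm \<theta>) / I) \<longlongrightarrow> 1) at_infinity"
      by (rule filterlim_compose) (rule filterlim_norm_at_top)
    have "\<forall>\<^sub>F \<theta>::real in at_infinity. \<theta> \<noteq> 0"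
      unfolding eventually_at_infinity by (intro exI[of _ 1]) auto
    then have "\<forall>\<^sub>F \<theta> in at_infinity. J (norm \<theta>) / I =
        enn2real (ila_prior a b \<gamma> L \<theta>) / (c * \<bar>\<theta>\<bar> powr (- 2 * b - 1) * l \<bar>\<theta>\<bar>)"
    proof eventually_elim
      case (elim \<theta>)
      let ?A = "1 / sqrt (2 * pi) * \<bar>\<theta>\<bar> powr (- 2 * b - 1) * l \<bar>\<theta>\<bar>"
      have A: "0 < ?A" using elim l_pos by simp
      have "ila_prior_kernel a b \<gamma> L \<theta> = ila_prior_kernel a b \<gamma> L \<bar>\<theta>\<bar>"
        by (simp add: ila_prior_kernel_def)
      also have "\<dots> = ennreal (?A * J \<bar>\<theta>\<bar>)"
        using ila_prior_kernel_eq_scaled[OF assms, of "\<bar>\<theta>\<bar>"] elim by (simp add: l_def J_def)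
      finally have "ila_prior a b \<gamma> L \<theta> = ennreal (?A * J \<bar>\<theta>\<bar>) / ennreal n"
        using n by (simp only: ila_prior_def normalized_def)
      moreover have nonneg: "0 \<le> ?A * J \<bar>\<theta>\<bar>"
        by (intro mult_nonneg_nonneg J_nonneg less_imp_le[OF A])
      ultimately have "ila_prior a b \<gamma> L \<theta> = ennreal (?A * J \<bar>\<theta>\<bar> / n)"
        using n by (simp only: divide_ennreal)
      then have "enn2real (ila_prior a b \<gamma> L \<theta>) = ?A * J \<bar>\<theta>\<bar> / n"
        using n nonneg by (simp only: enn2real_ennreal divide_nonneg_pos)
      then show ?case using A J n l_pos[of "\<bar>\<theta>\<bar>"] elim by (simp add: c_def)
    qed
    from Lim_transform_eventually[OF * this] show ?thesis .
  qed
  ultimately show ?thesis using c by blast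
qed

subsection \<open>Concentration of the shrinkage factor\<close>

text \<open>The kernel for b = 0 as a real function without its indicator, so that Bochner integrals
  and real dominated convergence apply.\<close>

definition kappa_weight :: "real \<Rightarrow> real \<Rightarrow> nat \<Rightarrow> real \<Rightarrow> real" where
  "kappa_weight a \<gamma> L \<kappa> = \<kappa> powr - 1 * (1 - \<kappa>) powr (a - 1) * log_adjustment \<gamma> L (1 / \<kappa>)"

lemma measurable_kappa_weight [measurable]: "kappa_weight a \<gamma> L \<in> borel_measurable borel"
  unfolding kappa_weight_def[abs_def] by measurable

lemma kappa_weight_pos: "0 < \<kappa> \<Longrightarrow> \<kappa> < 1 \<Longrightarrow> 0 < kappa_weight a \<gamma> L \<kappa>"
  unfolding kappa_weight_def by (auto intro!: mult_pos_pos divide_pos_pos log_adjustment_pos)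

text \<open>The bound is free of L, as dominated convergence in L demands; it uses only that the
  adjustment is at most 1 and 1/\<kappa> \<le> 1/\<epsilon>.\<close>

lemma kappa_weight_le:
  assumes "0 < \<gamma>" "0 < \<epsilon>" "\<epsilon> \<le> \<kappa>" "\<kappa> < 1"
  shows "kappa_weight a \<gamma> L \<kappa> \<le> 1 / \<epsilon> * (1 - \<kappa>) powr (a - 1)"
proof -
  have "kappa_weight a \<gamma> L \<kappa> \<le> 1 / \<epsilon> * (1 - \<kappa>) powr (a - 1) * 1"
    unfolding kappa_weight_def using assms
    by (intro mult_mono log_adjustment_le_1) (auto simp: powr_minus_divide frac_le intro!: less_imp_le[OF log_adjustment_pos])
  then show ?thesis by simp
qed

lemma set_integrable_kappa_weight:
  assumes "0 < a" "0 < \<gamma>" "1 \<le> L"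
  shows "set_integrable lborel {0<..<1} (kappa_weight a \<gamma> L)"
  unfolding set_integrable_def
proof (rule Bochner_Integration.integrable_bound)
  \<comment> \<open>The first 2 bounds \<open>(1 - \<kappa>) powr (a - 1)\<close> on (0, 1/2), the
    second bounds 1/\<kappa> on [1/2, 1). The surplus of the second term on (0, 1/2) is harmless
    because it is nonnegative.\<close>
  let ?W = "\<lambda>\<kappa>. 2 * (indicator {0<..<1/2} \<kappa> *\<^sub>R (log_adjustment \<gamma> L (1 / \<kappa>) / \<kappa>))
    + 2 * (indicator {0<..<1} \<kappa> *\<^sub>R (1 - \<kappa>) powr (a - 1))"
  show "integrable lborel ?W"
    using set_integral_log_adjustment_inverse(1)[OF assms(2,3)] set_integrable_powr(2)[OF assms(1)]
    unfolding set_integrable_def by (intro Bochner_Integration.integrable_add integrable_mult_right)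
  show "AE \<kappa> in lborel. norm (indicator {0<..<1} \<kappa> *\<^sub>R kappa_weight a \<gamma> L \<kappa>) \<le> norm (?W \<kappa>)"
  proof (intro AE_I2)
    fix \<kappa> :: real
    consider "\<kappa> \<notin> {0<..<1}" | "0 < \<kappa>" "\<kappa> < 1/2" | "1/2 \<le> \<kappa>" "\<kappa> < 1" by force
    then show "norm (indicator {0<..<1} \<kappa> *\<^sub>R kappa_weight a \<gamma> L \<kappa>) \<le> norm (?W \<kappa>)"
    proof cases
      case 2
      have h: "0 < log_adjustment \<gamma> L (1 / \<kappa>)" using 2 by (intro log_adjustment_pos) auto
      have "kappa_weight a \<gamma> L \<kappa> = (1 - \<kappa>) powr (a - 1) * (log_adjustment \<gamma> L (1 / \<kappa>) / \<kappa>)"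
        using 2 by (simp add: kappa_weight_def powr_minus_divide)
      also have "\<dots> \<le> 2 * (log_adjustment \<gamma> L (1 / \<kappa>) / \<kappa>)"
        using 2 h assms by (intro mult_right_mono powr_minus_one_bounds(2)) auto
      finally have "kappa_weight a \<gamma> L \<kappa> \<le> ?W \<kappa>" using 2 by (auto intro: add_increasing2)
      then show ?thesis using 2 kappa_weight_pos[of \<kappa> a \<gamma> L] by simp
    next
      case 3
      then have "kappa_weight a \<gamma> L \<kappa> \<le> ?W \<kappa>"
        using kappa_weight_le[of \<gamma> "1/2" \<kappa> a L] assms by simp
      then show ?thesis using 3 kappa_weight_pos[of \<kappa> a \<gamma> L] by simp
    qed simp
  qed
qed simp

text \<open>The left-hand side is free of L: on (0, 1/2) the integral is explicit in
  \<open>iter_log L 2\<close>, and this never exceeds 2, so its negative power is at least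
  \<open>2 powr - \<gamma>\<close>.\<close>

lemma integral_kappa_weight_ge:
  assumes "0 < a" "0 < \<gamma>" "1 \<le> L"
  shows "(1/2) powr a * (2 powr - \<gamma> / \<gamma>) \<le> (LINT \<kappa>:{0<..<1}|lborel. kappa_weight a \<gamma> L \<kappa>)"
proof -
  have "2 powr - \<gamma> / \<gamma> \<le> iter_log L 2 powr - \<gamma> / \<gamma>"
    using assms iter_log_le_self[of 2 L] iter_log_pos[of 2 L]
    by (intro divide_right_mono powr_mono2') auto
  also have "\<dots> = (LINT \<kappa>:{0<..<1/2}|lborel. log_adjustment \<gamma> L (1 / \<kappa>) / \<kappa>)"
    using set_integral_log_adjustment_inverse(2)[OF assms(2,3)] by simp
  finally have "(1/2) powr a * (2 powr - \<gamma> / \<gamma>)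
      \<le> (1/2) powr a * (LINT \<kappa>:{0<..<1/2}|lborel. log_adjustment \<gamma> L (1 / \<kappa>) / \<kappa>)"
    by (intro mult_left_mono) auto
  also have "\<dots> = (LINT \<kappa>|lborel. (1/2) powr a * (indicator {0<..<1/2} \<kappa> *\<^sub>R (log_adjustment \<gamma> L (1 / \<kappa>) / \<kappa>)))"
    unfolding set_lebesgue_integral_def by (rule integral_mult_right_zero[symmetric])
  also have "\<dots> \<le> (LINT \<kappa>:{0<..<1}|lborel. kappa_weight a \<gamma> L \<kappa>)"
    unfolding set_lebesgue_integral_def
  proof (rule integral_mono)
    show "integrable lborel (\<lambda>\<kappa>. (1/2) powr a * (indicator {0<..<1/2} \<kappa> *\<^sub>R (log_adjustment \<gamma> L (1 / \<kappa>) / \<kappa>)))"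
      using set_integral_log_adjustment_inverse(1)[OF assms(2,3)]
      unfolding set_integrable_def by (rule integrable_mult_right)
    show "integrable lborel (\<lambda>\<kappa>. indicator {0<..<1} \<kappa> *\<^sub>R kappa_weight a \<gamma> L \<kappa>)"
      using set_integrable_kappa_weight[OF assms] unfolding set_integrable_def .
    fix \<kappa> :: real
    show "(1/2) powr a * (indicator {0<..<1/2} \<kappa> *\<^sub>R (log_adjustment \<gamma> L (1 / \<kappa>) / \<kappa>))
        \<le> indicator {0<..<1} \<kappa> *\<^sub>R kappa_weight a \<gamma> L \<kappa>"
    proof (cases "\<kappa> \<in> {0<..<1/2}")
      case True
      then have h: "0 < log_adjustment \<gamma> L (1 / \<kappa>)" by (intro log_adjustment_pos) auto
      have "(1/2) powr a * (log_adjustment \<gamma> L (1 / \<kappa>) / \<kappa>)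
          \<le> (1 - \<kappa>) powr (a - 1) * (log_adjustment \<gamma> L (1 / \<kappa>) / \<kappa>)"
        using True h assms by (intro mult_right_mono powr_minus_one_bounds(1)) auto
      also have "\<dots> = kappa_weight a \<gamma> L \<kappa>"
        using True by (simp add: kappa_weight_def powr_minus_divide)
      finally show ?thesis using True by simp
    next
      case False
      then show ?thesis using kappa_weight_pos[of \<kappa> a \<gamma> L] by (auto simp: indicator_def)
    qed
  qed
  finally show ?thesis .
qed

text \<open>For \<kappa> < 1 the argument 1/\<kappa> exceeds 1, so the adjustment tends to 0
  pointwise; the dominating function is integrable because a > 0.\<close>

lemma integral_kappa_weight_away_tendsto_0:
  assumes "0 < a" "0 < \<gamma>" "0 < \<epsilon>" "\<epsilon> < 1"
  shows "(\<lambda>L. LINT \<kappa>:{\<epsilon>..<1}|lborel. kappa_weight a \<gamma> L \<kappa>) \<longlonglongrightarrow> 0"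
proof -
  have "(\<lambda>L. LINT \<kappa>|lborel. indicator {\<epsilon>..<1} \<kappa> *\<^sub>R kappa_weight a \<gamma> L \<kappa>) \<longlonglongrightarrow> (LINT \<kappa>::real|lborel. (0::real))"
  proof (rule integral_dominated_convergence)
    show "integrable lborel (\<lambda>\<kappa>. 1 / \<epsilon> * (indicator {0<..<1} \<kappa> *\<^sub>R (1 - \<kappa>) powr (a - 1)))"
      using set_integrable_powr(2)[OF assms(1)] unfolding set_integrable_def by (rule integrable_mult_right)
    show "AE \<kappa> in lborel. (\<lambda>L. indicator {\<epsilon>..<1} \<kappa> *\<^sub>R kappa_weight a \<gamma> L \<kappa>) \<longlonglongrightarrow> 0"
    proof (intro AE_I2)
      fix \<kappa> :: real
      show "(\<lambda>L. indicator {\<epsilon>..<1} \<kappa> *\<^sub>R kappa_weight a \<gamma> L \<kappa>) \<longlonglongrightarrow> 0"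
      proof (cases "\<kappa> \<in> {\<epsilon>..<1}")
        case True
        then have "(\<lambda>L. log_adjustment \<gamma> L (1 / \<kappa>)) \<longlonglongrightarrow> 0"
          using assms by (intro log_adjustment_tendsto_0) auto
        then have "(\<lambda>L. indicator {\<epsilon>..<1} \<kappa> *\<^sub>R kappa_weight a \<gamma> L \<kappa>) \<longlonglongrightarrow>
            indicator {\<epsilon>..<1} \<kappa> *\<^sub>R (\<kappa> powr - 1 * (1 - \<kappa>) powr (a - 1) * 0)"
          unfolding kappa_weight_def by (intro tendsto_scaleR tendsto_mult tendsto_const)
        then show ?thesis by simp
      qed simp
    qed
    show "AE \<kappa> in lborel. norm (indicator {\<epsilon>..<1} \<kappa> *\<^sub>R kappa_weight a \<gamma> L \<kappa>)
        \<le> 1 / \<epsilon> * (indicator {0<..<1} \<kappa> *\<^sub>R (1 - \<kappa>) powr (a - 1))" for L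
    proof (intro AE_I2)
      fix \<kappa> :: real
      show "norm (indicator {\<epsilon>..<1} \<kappa> *\<^sub>R kappa_weight a \<gamma> L \<kappa>)
        \<le> 1 / \<epsilon> * (indicator {0<..<1} \<kappa> *\<^sub>R (1 - \<kappa>) powr (a - 1))"
        using kappa_weight_le[OF assms(2,3), of \<kappa> a L] kappa_weight_pos[of \<kappa> a \<gamma> L] assms
        by (auto simp: indicator_def)
    qed
  qed simp_all
  then show ?thesis by (simp add: set_lebesgue_integral_def)
qed

text \<open>Turns the normalized mass near 0 into real integrals: the total is finite and positive,
  and (0, 1) is cut at \<epsilon>.\<close>

lemma kappa_density_mass:
  assumes "0 < a" "0 < \<gamma>" "1 \<le> L" "0 < \<epsilon>" "\<epsilon> < 1"
  shows "(\<integral>\<^sup>+\<kappa>\<in>{0<..<\<epsilon>}. kappa_density a 0 \<gamma> L \<kappa> \<partial>lborel) =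
    ennreal (1 - (LINT \<kappa>:{\<epsilon>..<1}|lborel. kappa_weight a \<gamma> L \<kappa>) / (LINT \<kappa>:{0<..<1}|lborel. kappa_weight a \<gamma> L \<kappa>))"
proof -
  let ?w = "kappa_weight a \<gamma> L"
  let ?n = "LINT \<kappa>:{0<..<1}|lborel. ?w \<kappa>"
  note int = set_integrable_kappa_weight[OF assms(1-3)]
  have int1: "set_integrable lborel {0<..<\<epsilon>} ?w" and int2: "set_integrable lborel {\<epsilon>..<1} ?w"
    using assms by (auto intro!: set_integrable_subset[OF int])
  have "0 < (1/2) powr a * (2 powr - \<gamma> / \<gamma>)" using assms by simp
  then have n: "0 < ?n" using integral_kappa_weight_ge[OF assms(1-3)] by linarith
  have kernel: "kappa_kernel a 0 \<gamma> L \<kappa> = ennreal (?w \<kappa>) * indicator {0<..<1} \<kappa>" for \<kappa>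
    by (simp add: kappa_kernel_def kappa_weight_def)
  have N: "(\<integral>\<^sup>+\<kappa>. kappa_kernel a 0 \<gamma> L \<kappa> \<partial>lborel) = ennreal ?n"
    unfolding kernel
    by (intro nn_set_integral_eq_ennreal_set_integral int) (auto intro!: less_imp_le[OF kappa_weight_pos])
  have "?n = (LINT \<kappa>:{0<..<\<epsilon>} \<union> {\<epsilon>..<1}|lborel. ?w \<kappa>)"
    using assms by (intro arg_cong[of _ _ "\<lambda>A. LINT \<kappa>:A|lborel. ?w \<kappa>"]) auto
  also have "\<dots> = (LINT \<kappa>:{0<..<\<epsilon>}|lborel. ?w \<kappa>) + (LINT \<kappa>:{\<epsilon>..<1}|lborel. ?w \<kappa>)"
    by (intro set_integral_Un int1 int2) auto
  finally have split: "(LINT \<kappa>:{0<..<\<epsilon>}|lborel. ?w \<kappa>) = ?n - (LINT \<kappa>:{\<epsilon>..<1}|lborel. ?w \<kappa>)" by simp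
  have nonneg: "0 \<le> (LINT \<kappa>:{0<..<\<epsilon>}|lborel. ?w \<kappa>)"
    unfolding set_lebesgue_integral_def using assms
    by (intro integral_nonneg_AE AE_I2) (auto simp: indicator_def intro!: less_imp_le[OF kappa_weight_pos])
  have "(\<integral>\<^sup>+\<kappa>\<in>{0<..<\<epsilon>}. kappa_density a 0 \<gamma> L \<kappa> \<partial>lborel)
      = (\<integral>\<^sup>+\<kappa>. ennreal (?w \<kappa>) * indicator {0<..<\<epsilon>} \<kappa> / ennreal ?n \<partial>lborel)"
    unfolding kappa_density_def normalized_def N kernel using assms
    by (intro nn_integral_cong) (auto simp: indicator_def)
  also have "\<dots> = (\<integral>\<^sup>+\<kappa>\<in>{0<..<\<epsilon>}. ennreal (?w \<kappa>) \<partial>lborel) / ennreal ?n"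
    by (intro nn_integral_divide) measurable
  also have "(\<integral>\<^sup>+\<kappa>\<in>{0<..<\<epsilon>}. ennreal (?w \<kappa>) \<partial>lborel) = ennreal (LINT \<kappa>:{0<..<\<epsilon>}|lborel. ?w \<kappa>)"
    using assms by (intro nn_set_integral_eq_ennreal_set_integral int1) (auto intro!: less_imp_le[OF kappa_weight_pos])
  also have "\<dots> / ennreal ?n = ennreal ((LINT \<kappa>:{0<..<\<epsilon>}|lborel. ?w \<kappa>) / ?n)"
    using nonneg n by (rule divide_ennreal)
  also have "(LINT \<kappa>:{0<..<\<epsilon>}|lborel. ?w \<kappa>) / ?n = 1 - (LINT \<kappa>:{\<epsilon>..<1}|lborel. ?w \<kappa>) / ?n"
    unfolding split using n by (simp add: diff_divide_distrib)
  finally show ?thesis .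
qed

text \<open>The mass away from 0 vanishes while the total mass stays above a positive constant
  independent of L, so their quotient tends to 0.\<close>

lemma kappa_density_concentrates:
  assumes "0 < a" "0 < \<gamma>" "0 < \<epsilon>" "\<epsilon> < 1"
  shows "(\<lambda>L. \<integral>\<^sup>+\<kappa>\<in>{0<..<\<epsilon>}. kappa_density a 0 \<gamma> L \<kappa> \<partial>lborel) \<longlonglongrightarrow> 1"
proof -
  define d where "d L = (LINT \<kappa>:{\<epsilon>..<1}|lborel. kappa_weight a \<gamma> L \<kappa>)" for L
  define n where "n L = (LINT \<kappa>:{0<..<1}|lborel. kappa_weight a \<gamma> L \<kappa>)" for L
  define c where "c = (1/2) powr a * (2 powr - \<gamma> / \<gamma>)"
  have c: "0 < c" using assms by (simp add: c_def)
  have d: "d \<longlonglongrightarrow> 0" unfolding d_def by (rule integral_kappa_weight_away_tendsto_0[OF assms])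
  have d_nonneg: "0 \<le> d L" for L
    unfolding d_def set_lebesgue_integral_def using assms
    by (intro integral_nonneg_AE AE_I2) (auto simp: indicator_def intro!: less_imp_le[OF kappa_weight_pos])
  have n_ge: "c \<le> n L" if "1 \<le> L" for L
    unfolding c_def n_def using integral_kappa_weight_ge[OF assms(1,2) that] .
  have "(\<lambda>L. d L / n L) \<longlonglongrightarrow> 0"
  proof (rule tendsto_sandwich[OF _ _ tendsto_const])
    show "\<forall>\<^sub>F L in sequentially. 0 \<le> d L / n L"
      using eventually_ge_at_top[of 1]
    proof eventually_elim
      case (elim L)
      then show ?case using d_nonneg[of L] n_ge[of L] c by simp
    qed
    show "\<forall>\<^sub>F L in sequentially. d L / n L \<le> d L / c"
      using eventually_ge_at_top[of 1]
    proof eventually_elim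
      case (elim L)
      then show ?case using d_nonneg[of L] n_ge[of L] c by (intro divide_left_mono) auto
    qed
    show "(\<lambda>L. d L / c) \<longlonglongrightarrow> 0" using tendsto_divide[OF d tendsto_const[of c]] c by simp
  qed
  then have "(\<lambda>L. ennreal (1 - d L / n L)) \<longlonglongrightarrow> ennreal (1 - 0)"
    by (intro tendsto_intros)
  then have "(\<lambda>L. ennreal (1 - d L / n L)) \<longlonglongrightarrow> 1" by simp
  \<comment> \<open>The mass formula needs L \<ge> 1; level 0 is irrelevant to the limit.\<close>
  moreover have "\<forall>\<^sub>F L in sequentially. ennreal (1 - d L / n L)
      = (\<integral>\<^sup>+\<kappa>\<in>{0<..<\<epsilon>}. kappa_density a 0 \<gamma> L \<kappa> \<partial>lborel)"
    using eventually_ge_at_top[of 1]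
  proof eventually_elim
    case (elim L)
    then show ?case using kappa_density_mass[OF assms(1,2) elim assms(3,4)] by (simp add: d_def n_def)
  qed
  ultimately show ?thesis by (rule Lim_transform_eventually)
qed

theorem theorem3:
  fixes a b \<gamma> :: real
  assumes "a > 0" and "b \<ge> 0" and "\<gamma> > 0"
  shows "(\<forall>L\<ge>1.
            (\<integral>\<^sup>+\<theta>. ila_prior_kernel a b \<gamma> L \<theta> \<partial>lborel) < \<infinity>
          \<and> (a \<le> 1/2 \<longrightarrow> (ila_prior a b \<gamma> L \<longlongrightarrow> \<infinity>) (at 0))
          \<and> (\<exists>c>0. \<exists>l. slowly_varying l \<and>
               ((\<lambda>\<theta>. enn2real (ila_prior a b \<gamma> L \<theta>) / (c * \<bar>\<theta>\<bar> powr (- 2 * b - 1) * l \<bar>\<theta>\<bar>))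
                  \<longlongrightarrow> 1) at_infinity))
       \<and> (b = 0 \<longrightarrow>
            (\<forall>\<epsilon>. 0 < \<epsilon> \<and> \<epsilon> < 1 \<longrightarrow>
               (\<lambda>L. \<integral>\<^sup>+\<kappa>\<in>{0<..<\<epsilon>}. kappa_density a b \<gamma> L \<kappa> \<partial>lborel) \<longlonglongrightarrow> 1))"
proof (intro conjI allI impI)
  fix L :: nat assume L: "1 \<le> L"
  show "(\<integral>\<^sup>+\<theta>. ila_prior_kernel a b \<gamma> L \<theta> \<partial>lborel) < \<infinity>"
    by (rule nn_integral_ila_prior_kernel_less_top[OF assms L])
  show "(ila_prior a b \<gamma> L \<longlongrightarrow> \<infinity>) (at 0)" if "a \<le> 1/2"
    by (rule ila_prior_tendsto_top[OF assms(1) that assms(2,3) L])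
  show "\<exists>c>0. \<exists>l. slowly_varying l \<and>
      ((\<lambda>\<theta>. enn2real (ila_prior a b \<gamma> L \<theta>) / (c * \<bar>\<theta>\<bar> powr (- 2 * b - 1) * l \<bar>\<theta>\<bar>)) \<longlongrightarrow> 1) at_infinity"
    by (rule ila_prior_tail[OF assms L])
next
  fix \<epsilon> :: real assume "b = 0" "0 < \<epsilon> \<and> \<epsilon> < 1"
  then show "(\<lambda>L. \<integral>\<^sup>+\<kappa>\<in>{0<..<\<epsilon>}. kappa_density a b \<gamma> L \<kappa> \<partial>lborel) \<longlonglongrightarrow> 1"
    using kappa_density_concentrates[OF assms(1,3)] by simp
qed

end
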